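(* Let $n\ge2$ and let $r$ be even with $0<r\le n$. Consider $A,B\in\mathrm{SGL}_n(\mathbb{F}_2)$ with $B-A=\sum_{i=1}^{r+1}\mathbf{x}_i\mathbf{x}_i^{\top}$, where $\mathbf{x}_1,\ldots,\mathbf{x}_r\in\mathbb{F}_2^n$ are linearly independent and $\mathbf{x}_{r+1}=\sum_{i=1}^r\mathbf{x}_i$. (i) Such $A,B,\mathbf{x}_1,\ldots,\mathbf{x}_r$ with $[\mathbf{x}_i^{\top}A^{-1}\mathbf{x}_j]_{i,j=1}^{r+1}$ not of rank one exist if and only if $(r,n)\notin\{(2,2),(2,3)\}$. (ii) Such $A,B,\mathbf{x}_1,\ldots,\mathbf{x}_r$ with $[\mathbf{x}_i^{\top}A^{-1}\mathbf{x}_j]_{i,j=1}^{r+1}$ of rank one exist if and only if $r\le\lfloor\frac{n+1}{2}\rfloor$.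
   Context: $\mathbb{F}_2$ is the binary field; $\mathrm{SGL}_n(\mathbb{F}_2)$ denotes the set of invertible symmetric $n\times n$ matrices over $\mathbb{F}_2$. *)

theory Defs
  imports "Jordan_Normal_Form.DL_Rank" "HOL-Library.Z2"
begin

text \<open>Matrices over the binary field are represented by Jordan_Normal_Form matrices
  with entries in the field type bit (HOL-Library.Z2).\<close>

definition SGL :: "nat \<Rightarrow> bit mat \<Rightarrow> bool" where
  "SGL n A \<longleftrightarrow> A \<in> carrier_mat n n \<and> transpose_mat A = A \<and> invertible_mat A"

text \<open>Linear independence of the family x_1,...,x_r (a list of vectors in F_2^n).\<close>
definition lin_indep_list :: "nat \<Rightarrow> bit vec list \<Rightarrow> bool" where
  "lin_indep_list n xs \<longleftrightarrow> set xs \<subseteq> carrier_vec n \<and> distinct xs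
      \<and> LinearCombinations.module.lin_indpt class_ring (module_vec TYPE(bit) n) (set xs)"

text \<open>The extended family x_1,...,x_r, x_{r+1} with x_{r+1} = x_1 + ... + x_r.\<close>
definition ext_family :: "nat \<Rightarrow> bit vec list \<Rightarrow> bit vec list" where
  "ext_family n xs = xs @ [vec n (\<lambda>k. \<Sum>i<length xs. (xs ! i) $ k)]"

text \<open>Sum of x_i x_i^T over a list of vectors.\<close>
definition sum_outer :: "nat \<Rightarrow> bit vec list \<Rightarrow> bit mat" where
  "sum_outer n ys = mat n n (\<lambda>(a, b). \<Sum>i<length ys. (ys ! i) $ a * (ys ! i) $ b)"

text \<open>The matrix [x_i^T A^{-1} x_j]_{i,j}, given the inverse Ainv of A.\<close>
definition gram :: "bit mat \<Rightarrow> bit vec list \<Rightarrow> bit mat" where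
  "gram Ainv ys = mat (length ys) (length ys) (\<lambda>(i, j). (ys ! i) \<bullet> (Ainv *\<^sub>v (ys ! j)))"

text \<open>The configuration of the lemma: A, B in SGL_n(F_2), x_1..x_r linearly independent,
  B - A = sum_{i=1}^{r+1} x_i x_i^T; Ainv is the inverse of A.\<close>
definition config :: "nat \<Rightarrow> nat \<Rightarrow> bit mat \<Rightarrow> bit mat \<Rightarrow> bit mat \<Rightarrow> bit vec list \<Rightarrow> bool" where
  "config n r A B Ainv xs \<longleftrightarrow> SGL n A \<and> SGL n B \<and> length xs = r \<and> lin_indep_list n xs
      \<and> B - A = sum_outer n (ext_family n xs)
      \<and> Ainv \<in> carrier_mat n n \<and> A * Ainv = 1\<^sub>m n \<and> Ainv * A = 1\<^sub>m n"

end

theory Submission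
  imports Defs
begin

(* Write S = A^-1 and G = [x_i^T S x_j] for i, j <= r.  The matrix [x_i^T S x_j] over the
   extended family is G bordered by its row sums, column sums and total sum.  Since r is even,
   B = A + sum x_i x_i^T is invertible iff G + I + J is nonsingular (J the all-ones matrix):
   B w = 0 forces A w into the span of the x_i, so w = S (sum u_i x_i), and the coefficients u
   are exactly a kernel vector of G + I + J.
   If the bordered matrix has rank one it is v v^T with some v_p = 1 (p <= r); the r - 1 vectors
   x_j + v_j x_p (j /= p) are independent and their images under S are orthogonal to every x_i,
   hence r + (r - 1) <= n.  For r = 2 invertibility of B forces G_12 = G_11 G_22, so the bordered
   matrix has rank at most one; rank zero would make x_1, x_2 orthogonal to S x_1, S x_2, so 4 <= n.
   The examples take x_i = e_i, so that G is the leading r x r block of A^-1: a permutation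
   matrix of an involution gives G = E_11 (rank one, needs 2 r - 1 <= n) or G = 0 (rank zero,
   needs 2 r <= n), and for r >= 4 a block-diagonal A^-1 gives G + I + J nonsingular with G of
   rank at least two. *)

(* Keep bit arithmetic in ring form instead of rewriting it to xor/and. *)
declare add_bit_eq_xor [simp del] mult_bit_eq_and [simp del]

section \<open>Linear combinations of lists of vectors\<close>

definition lin_comb :: "nat \<Rightarrow> 'a :: comm_semiring_0 vec list \<Rightarrow> (nat \<Rightarrow> 'a) \<Rightarrow> 'a vec" where
  "lin_comb n vs c = vec n (\<lambda>i. \<Sum>j<length vs. c j * vs ! j $ i)"

definition lin_indep :: "nat \<Rightarrow> 'a :: comm_semiring_0 vec list \<Rightarrow> bool" where
  "lin_indep n vs \<longleftrightarrow> (\<forall>c. lin_comb n vs c = 0\<^sub>v n \<longrightarrow> (\<forall>j<length vs. c j = 0))"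

lemma lin_comb_carrier [simp]:
  "lin_comb n vs c \<in> carrier_vec n" "dim_vec (lin_comb n vs c) = n"
  by (simp_all add: lin_comb_def)

lemma index_lin_comb [simp]:
  "i < n \<Longrightarrow> lin_comb n vs c $ i = (\<Sum>j<length vs. c j * vs ! j $ i)"
  by (simp add: lin_comb_def)

lemma lin_comb_cong:
  "(\<And>j. j < length vs \<Longrightarrow> c j = d j) \<Longrightarrow> lin_comb n vs c = lin_comb n vs d"
  unfolding lin_comb_def by (intro arg_cong[where f = "vec n"] ext sum.cong) simp_all

lemma lin_indepD:
  "lin_indep n vs \<Longrightarrow> lin_comb n vs c = 0\<^sub>v n \<Longrightarrow> j < length vs \<Longrightarrow> c j = 0"
  unfolding lin_indep_def by blast

lemma lin_comb_zero_coeffs: "lin_comb n vs (\<lambda>_. 0) = 0\<^sub>v n"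
  by (rule eq_vecI) simp_all

lemma lin_comb_add:
  "lin_comb n vs c + lin_comb n vs d = lin_comb n vs (\<lambda>j. c j + d j)"
  by (rule eq_vecI) (simp_all add: sum.distrib distrib_right)

lemma mat_of_cols_mult_vec:
  assumes "b \<in> carrier_vec (length vs)"
  shows "mat_of_cols n vs *\<^sub>v b = lin_comb n vs (\<lambda>j. b $ j)"
proof (rule eq_vecI)
  fix i assume "i < dim_vec (lin_comb n vs (\<lambda>j. b $ j))"
  then have i: "i < n" by simp
  then show "(mat_of_cols n vs *\<^sub>v b) $ i = lin_comb n vs (\<lambda>j. b $ j) $ i"
    using assms by (simp add: mult_mat_vec_def scalar_prod_def mat_of_cols_index atLeast0LessThan
        row_def mult.commute)
qed simp

lemma lin_indep_distinct:
  fixes vs :: "'a :: comm_ring_1 vec list"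
  assumes "lin_indep n vs"
  shows "distinct vs"
proof (rule ccontr)
  assume "\<not> distinct vs"
  then obtain i j where ij: "i < length vs" "j < length vs" "i \<noteq> j" "vs ! i = vs ! j"
    by (metis distinct_conv_nth)
  define c :: "nat \<Rightarrow> 'a" where "c k = (if k = i then 1 else if k = j then -1 else 0)" for k
  have "lin_comb n vs c = 0\<^sub>v n"
  proof (rule eq_vecI)
    fix a assume "a < dim_vec (0\<^sub>v n :: 'a vec)"
    then have a: "a < n" by simp
    have "(\<Sum>k<length vs. c k * vs ! k $ a) = (\<Sum>k\<in>{i, j}. c k * vs ! k $ a)"
      by (rule sum.mono_neutral_right) (use ij in \<open>auto simp: c_def\<close>)
    also have "\<dots> = 0" using ij by (simp add: c_def)
    finally show "lin_comb n vs c $ a = 0\<^sub>v n $ a" using a by simp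
  qed simp
  then have "c i = 0" using lin_indepD[OF assms _ ij(1)] by blast
  then show False by (simp add: c_def)
qed

lemma lin_indpt_iff_lin_indep:
  fixes vs :: "'a :: field vec list"
  assumes vs: "set vs \<subseteq> carrier_vec n" and dist: "distinct vs"
  shows "LinearCombinations.module.lin_indpt class_ring (module_vec TYPE('a) n) (set vs)
    \<longleftrightarrow> lin_indep n vs"
proof -
  interpret V: vec_space "TYPE('a)" n .
  have cols: "set (cols (mat_of_cols n vs)) = set vs" "distinct (cols (mat_of_cols n vs))"
    using vs dist by simp_all
  have "V.lin_dep (set vs) \<longleftrightarrow> (\<exists>b\<in>carrier_vec (length vs). b \<noteq> 0\<^sub>v (length vs)
      \<and> mat_of_cols n vs *\<^sub>v b = 0\<^sub>v n)"
    using V.lin_depE[OF mat_of_cols_carrier(1), of vs] V.lin_depI[OF mat_of_cols_carrier(1), of _ vs]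
    cols by metis
  also have "\<dots> \<longleftrightarrow> \<not> lin_indep n vs"
  proof
    assume "\<exists>b\<in>carrier_vec (length vs). b \<noteq> 0\<^sub>v (length vs) \<and> mat_of_cols n vs *\<^sub>v b = 0\<^sub>v n"
    then obtain b where b: "b \<in> carrier_vec (length vs)" "b \<noteq> 0\<^sub>v (length vs)"
      "lin_comb n vs (\<lambda>j. b $ j) = 0\<^sub>v n"
      using mat_of_cols_mult_vec by metis
    from b(1,2) obtain j where "j < length vs" "b $ j \<noteq> 0" by (metis carrier_vecD eq_vecI index_zero_vec)
    then show "\<not> lin_indep n vs" using b(3) lin_indepD by metis
  next
    assume "\<not> lin_indep n vs"
    then obtain c j where c: "lin_comb n vs c = 0\<^sub>v n" "j < length vs" "c j \<noteq> 0"
      unfolding lin_indep_def by blast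
    define b where "b = vec (length vs) c"
    have "lin_comb n vs (\<lambda>j. b $ j) = lin_comb n vs c"
      by (rule lin_comb_cong) (simp add: b_def)
    moreover have "b \<noteq> 0\<^sub>v (length vs)" using c(2,3) by (metis b_def index_vec index_zero_vec(1))
    ultimately show "\<exists>b\<in>carrier_vec (length vs). b \<noteq> 0\<^sub>v (length vs) \<and> mat_of_cols n vs *\<^sub>v b = 0\<^sub>v n"
      using c(1) mat_of_cols_mult_vec[of b vs n] by (auto simp: b_def)
  qed
  finally show ?thesis by blast
qed

lemma lin_indep_list_iff: "lin_indep_list n xs \<longleftrightarrow> set xs \<subseteq> carrier_vec n \<and> lin_indep n xs"
  using lin_indpt_iff_lin_indep lin_indep_distinct unfolding lin_indep_list_def by blast

lemma lin_indep_length_le: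
  fixes vs :: "'a :: field vec list"
  assumes vs: "set vs \<subseteq> carrier_vec n" and ind: "lin_indep n vs"
  shows "length vs \<le> n"
proof -
  interpret V: vec_space "TYPE('a)" n .
  have dist: "distinct vs" using lin_indep_distinct[OF ind] .
  have "V.lin_indpt (set vs)" using lin_indpt_iff_lin_indep[OF vs dist] ind by simp
  then have "card (set vs) \<le> V.dim" using V.li_le_dim(2)[OF V.fin_dim] vs by simp
  then show ?thesis using V.dim_is_n distinct_card[OF dist] by simp
qed

lemma scalar_prod_lin_comb:
  fixes v :: "'a :: comm_semiring_0 vec"
  assumes v: "v \<in> carrier_vec n" and zs: "set zs \<subseteq> carrier_vec n"
  shows "v \<bullet> lin_comb n zs d = (\<Sum>k<length zs. d k * (v \<bullet> zs ! k))"
proof -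
  have "v \<bullet> lin_comb n zs d = (\<Sum>a<n. \<Sum>k<length zs. d k * (v $ a * zs ! k $ a))"
    using v by (simp add: scalar_prod_def atLeast0LessThan sum_distrib_left mult.left_commute)
  also have "\<dots> = (\<Sum>k<length zs. \<Sum>a<n. d k * (v $ a * zs ! k $ a))"
    by (rule sum.swap)
  also have "\<dots> = (\<Sum>k<length zs. d k * (v \<bullet> zs ! k))"
  proof (intro sum.cong refl)
    fix k assume "k \<in> {..<length zs}"
    then have "zs ! k \<in> carrier_vec n" using zs by auto
    then show "(\<Sum>a<n. d k * (v $ a * zs ! k $ a)) = d k * (v \<bullet> zs ! k)"
      by (simp add: scalar_prod_def sum_distrib_left atLeast0LessThan)
  qed
  finally show ?thesis .
qed

lemma mult_mat_vec_lin_comb: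
  assumes S: "S \<in> carrier_mat m n" and xs: "set xs \<subseteq> carrier_vec n"
  shows "S *\<^sub>v lin_comb n xs c = lin_comb m (map ((*\<^sub>v) S) xs) c"
proof (rule eq_vecI)
  fix a assume "a < dim_vec (lin_comb m (map ((*\<^sub>v) S) xs) c)"
  then have a: "a < m" by simp
  have "(S *\<^sub>v lin_comb n xs c) $ a = row S a \<bullet> lin_comb n xs c" using S a by simp
  also have "\<dots> = (\<Sum>k<length xs. c k * (row S a \<bullet> xs ! k))"
    using S a by (intro scalar_prod_lin_comb[OF _ xs]) simp
  also have "\<dots> = lin_comb m (map ((*\<^sub>v) S) xs) c $ a" using a S by simp
  finally show "(S *\<^sub>v lin_comb n xs c) $ a = lin_comb m (map ((*\<^sub>v) S) xs) c $ a" .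
qed (use S in simp)

lemma scalar_prod_mult_lin_comb:
  assumes S: "S \<in> carrier_mat n n" and xs: "set xs \<subseteq> carrier_vec n" and u: "u \<in> carrier_vec n"
  shows "u \<bullet> (S *\<^sub>v lin_comb n xs c) = (\<Sum>k<length xs. c k * (u \<bullet> (S *\<^sub>v xs ! k)))"
proof -
  have "set (map ((*\<^sub>v) S) xs) \<subseteq> carrier_vec n" using S xs by (auto intro: mult_mat_vec_carrier)
  then have "u \<bullet> lin_comb n (map ((*\<^sub>v) S) xs) c
      = (\<Sum>k<length (map ((*\<^sub>v) S) xs). c k * (u \<bullet> map ((*\<^sub>v) S) xs ! k))"
    by (rule scalar_prod_lin_comb[OF u])
  then show ?thesis unfolding mult_mat_vec_lin_comb[OF S xs] by simp
qed

lemma lin_comb_scalar_prod: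
  fixes u :: "'a :: comm_semiring_0 vec"
  assumes u: "u \<in> carrier_vec n" and xs: "set xs \<subseteq> carrier_vec n"
  shows "lin_comb n xs c \<bullet> u = (\<Sum>k<length xs. c k * (xs ! k \<bullet> u))"
proof -
  have "lin_comb n xs c \<bullet> u = u \<bullet> lin_comb n xs c" by (rule comm_scalar_prod[OF _ u]) simp
  also have "\<dots> = (\<Sum>k<length xs. c k * (xs ! k \<bullet> u))"
    unfolding scalar_prod_lin_comb[OF u xs] using xs u
    by (intro sum.cong refl) (metis comm_scalar_prod lessThan_iff nth_mem subsetD)
  finally show ?thesis .
qed

lemma lin_comb_snoc_lin_comb:
  "lin_comb n (xs @ [lin_comb n xs d]) c = lin_comb n xs (\<lambda>i. c i + c (length xs) * d i)"
proof (rule eq_vecI)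
  fix a assume "a < dim_vec (lin_comb n xs (\<lambda>i. c i + c (length xs) * d i))"
  then have a: "a < n" by simp
  have "lin_comb n (xs @ [lin_comb n xs d]) c $ a
      = (\<Sum>j<length xs. c j * xs ! j $ a) + c (length xs) * (\<Sum>j<length xs. d j * xs ! j $ a)"
    using a by (simp add: nth_append)
  also have "\<dots> = (\<Sum>j<length xs. (c j + c (length xs) * d j) * xs ! j $ a)"
    by (simp add: sum_distrib_left distrib_right sum.distrib mult.assoc)
  finally show "lin_comb n (xs @ [lin_comb n xs d]) c $ a = lin_comb n xs (\<lambda>i. c i + c (length xs) * d i) $ a"
    using a by simp
qed simp

lemma lin_comb_of_lin_combs:
  "lin_comb n (map (\<lambda>k. lin_comb n vs (c k)) [0..<m]) d = lin_comb n vs (\<lambda>j. \<Sum>k<m. d k * c k j)"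
proof (rule eq_vecI)
  fix a assume "a < dim_vec (lin_comb n vs (\<lambda>j. \<Sum>k<m. d k * c k j))"
  then have a: "a < n" by simp
  have "(\<Sum>k<m. d k * (\<Sum>j<length vs. c k j * vs ! j $ a))
      = (\<Sum>k<m. \<Sum>j<length vs. d k * c k j * vs ! j $ a)"
    by (simp add: sum_distrib_left mult.assoc)
  also have "\<dots> = (\<Sum>j<length vs. \<Sum>k<m. d k * c k j * vs ! j $ a)"
    by (rule sum.swap)
  also have "\<dots> = (\<Sum>j<length vs. (\<Sum>k<m. d k * c k j) * vs ! j $ a)"
    by (simp add: sum_distrib_right)
  finally show "lin_comb n (map (\<lambda>k. lin_comb n vs (c k)) [0..<m]) d $ a
      = lin_comb n vs (\<lambda>j. \<Sum>k<m. d k * c k j) $ a"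
    using a by simp
qed simp

lemma lin_comb_unit_vecs:
  assumes "r \<le> n" "j < r"
  shows "lin_comb n (map (unit_vec n) [0..<r]) c $ j = (c j :: 'a :: comm_semiring_1)"
proof -
  have "lin_comb n (map (unit_vec n) [0..<r]) c $ j = (\<Sum>k<r. if k = j then c k else 0)"
    using assms by (intro trans[OF index_lin_comb sum.cong]) (auto simp: unit_vec_def)
  also have "\<dots> = c j" using assms(2) by simp
  finally show ?thesis .
qed

lemma lin_indep_unit_vecs:
  assumes "r \<le> n"
  shows "lin_indep n (map (unit_vec n) [0..<r] :: 'a :: comm_semiring_1 vec list)"
  unfolding lin_indep_def
proof (intro allI impI)
  fix c :: "nat \<Rightarrow> 'a" and j
  assume "lin_comb n (map (unit_vec n) [0..<r]) c = 0\<^sub>v n"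
    and "j < length (map (unit_vec n) [0..<r] :: 'a vec list)"
  then have "j < r" and "lin_comb n (map (unit_vec n) [0..<r]) c $ j = 0" using assms by simp_all
  then show "c j = 0" by (simp add: lin_comb_unit_vecs[OF assms])
qed

lemma lin_indep_pivot_lin_combs:
  fixes xs :: "'a :: comm_semiring_1 vec list"
  assumes xs: "lin_indep n xs" and q: "\<And>k. k < m \<Longrightarrow> q k < length xs"
    and c: "\<And>k l. k < m \<Longrightarrow> l < m \<Longrightarrow> c l (q k) = (if l = k then 1 else 0)"
  shows "lin_indep n (map (\<lambda>k. lin_comb n xs (c k)) [0..<m])"
  unfolding lin_indep_def
proof (intro allI impI)
  fix d :: "nat \<Rightarrow> 'a" and k
  assume d: "lin_comb n (map (\<lambda>k. lin_comb n xs (c k)) [0..<m]) d = 0\<^sub>v n"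
    and k: "k < length (map (\<lambda>k. lin_comb n xs (c k)) [0..<m])"
  then have k: "k < m" by simp
  have "(\<Sum>l<m. d l * c l (q k)) = 0"
    using lin_indepD[OF xs _ q[OF k]] d by (simp add: lin_comb_of_lin_combs)
  moreover have "(\<Sum>l<m. d l * c l (q k)) = (\<Sum>l<m. if l = k then d l else 0)"
    using c[OF k] by (intro sum.cong) auto
  moreover have "\<dots> = d k" using k by simp
  ultimately show "d k = 0" by simp
qed

lemma exists_not_lin_comb:
  fixes vs :: "'a :: field vec list"
  assumes vs: "set vs \<subseteq> carrier_vec n" and len: "length vs < n"
  obtains u where "u \<in> carrier_vec n" "\<And>c. lin_comb n vs c \<noteq> u"
proof (rule ccontr)
  (* Otherwise the coefficient vectors of e_1, ..., e_n are n independent vectors of length |vs|. *)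
  assume "\<not> thesis"
  then have "\<forall>i<n. \<exists>c. lin_comb n vs c = unit_vec n i" using that unit_vec_carrier by metis
  then obtain C where C: "\<And>i. i < n \<Longrightarrow> lin_comb n vs (C i) = unit_vec n i" by metis
  define ys where "ys = map (\<lambda>i. vec (length vs) (C i)) [0..<n]"
  have "lin_indep (length vs) ys"
    unfolding lin_indep_def
  proof (intro allI impI)
    fix d :: "nat \<Rightarrow> 'a" and i
    assume d: "lin_comb (length vs) ys d = 0\<^sub>v (length vs)" and i: "i < length ys"
    have "lin_comb n vs (\<lambda>j. \<Sum>k<n. d k * C k j) = lin_comb n vs (\<lambda>_. 0)"
    proof (rule lin_comb_cong)
      fix j assume "j < length vs"
      then show "(\<Sum>k<n. d k * C k j) = 0"
        using arg_cong[OF d, of "\<lambda>v. v $ j"] by (simp add: ys_def)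
    qed
    moreover have "map (\<lambda>k. lin_comb n vs (C k)) [0..<n] = map (unit_vec n) [0..<n]"
      by (intro map_cong) (simp_all add: C)
    ultimately have "lin_comb n (map (unit_vec n) [0..<n]) d = 0\<^sub>v n"
      using lin_comb_of_lin_combs[of n vs C n d] lin_comb_zero_coeffs by metis
    then show "d i = 0"
      using lin_indepD[OF lin_indep_unit_vecs[OF order.refl]] i by (simp add: ys_def)
  qed
  moreover have "set ys \<subseteq> carrier_vec (length vs)" by (auto simp: ys_def)
  ultimately have "length ys \<le> length vs" by (rule lin_indep_length_le[rotated])
  then show False using len by (simp add: ys_def)
qed

lemma lin_indep_snoc:
  fixes vs :: "'a :: field vec list"
  assumes ind: "lin_indep n vs" and u: "u \<in> carrier_vec n" and new: "\<And>c. lin_comb n vs c \<noteq> u"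
  shows "lin_indep n (vs @ [u])"
  unfolding lin_indep_def
proof (intro allI impI)
  fix c :: "nat \<Rightarrow> 'a" and j
  assume c: "lin_comb n (vs @ [u]) c = 0\<^sub>v n" and j: "j < length (vs @ [u])"
  let ?l = "length vs"
  have comp: "lin_comb n vs c $ i + c ?l * u $ i = 0" if "i < n" for i
    using arg_cong[OF c, of "\<lambda>v. v $ i"] that by (simp add: nth_append)
  have cl: "c ?l = 0"
  proof (rule ccontr)
    assume nz: "c ?l \<noteq> 0"
    have "lin_comb n vs (\<lambda>j. - c j / c ?l) = u"
    proof (rule eq_vecI)
      fix i assume "i < dim_vec u"
      then have i: "i < n" using u by simp
      have "u $ i = - lin_comb n vs c $ i / c ?l"
        using comp[OF i] nz by (simp add: field_simps add_eq_0_iff)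
      also have "\<dots> = (\<Sum>j<?l. - c j / c ?l * vs ! j $ i)"
        using i by (simp add: sum_divide_distrib flip: sum_negf)
      finally show "lin_comb n vs (\<lambda>j. - c j / c ?l) $ i = u $ i" using i by simp
    qed (use u in simp)
    then show False using new by blast
  qed
  have "lin_comb n vs c = 0\<^sub>v n" using comp cl by (intro eq_vecI) simp_all
  then have "c j = 0" if "j < ?l" for j using lin_indepD[OF ind] that by blast
  then show "c j = 0" using cl j by (metis length_append_singleton less_Suc_eq)
qed

lemma lin_indep_extend:
  fixes vs :: "'a :: field vec list"
  assumes "set vs \<subseteq> carrier_vec n" "lin_indep n vs"
  obtains es where "set es \<subseteq> carrier_vec n" "length vs + length es = n" "lin_indep n (vs @ es)"
proof -
  have "\<exists>es. set es \<subseteq> carrier_vec n \<and> length vs + length es = n \<and> lin_indep n (vs @ es)"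
    using assms
  proof (induction "n - length vs" arbitrary: vs)
    case 0
    then show ?case using lin_indep_length_le[of vs n] by (intro exI[of _ "[]"]) auto
  next
    case (Suc k)
    then obtain u where u: "u \<in> carrier_vec n" "\<And>c. lin_comb n vs c \<noteq> u"
      using exists_not_lin_comb[of vs n] by (metis zero_less_Suc zero_less_diff)
    have "k = n - length (vs @ [u])" using Suc.hyps(2) by simp
    moreover have "set (vs @ [u]) \<subseteq> carrier_vec n" using Suc.prems(1) u(1) by simp
    moreover have "lin_indep n (vs @ [u])" using lin_indep_snoc[OF Suc.prems(2) u] .
    ultimately obtain es where "set es \<subseteq> carrier_vec n" "length (vs @ [u]) + length es = n"
        "lin_indep n ((vs @ [u]) @ es)"
      using Suc.hyps(1) by blast
    then show ?case using u(1) by (intro exI[of _ "u # es"]) auto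
  qed
  then show ?thesis using that by blast
qed

lemma orthogonal_to_basis_eq_zero:
  fixes L :: "'a :: field vec list"
  assumes L: "set L \<subseteq> carrier_vec n" "length L = n" "lin_indep n L"
    and z: "z \<in> carrier_vec n" and orth: "\<And>j. j < n \<Longrightarrow> L ! j \<bullet> z = 0"
  shows "z = 0\<^sub>v n"
proof -
  have P: "mat_of_cols n L \<in> carrier_mat n n" using L(2) by (metis mat_of_cols_carrier(1))
  have "det (mat_of_cols n L) \<noteq> 0"
  proof
    assume "det (mat_of_cols n L) = 0"
    then obtain b where b: "b \<in> carrier_vec n" "b \<noteq> 0\<^sub>v n" "mat_of_cols n L *\<^sub>v b = 0\<^sub>v n"
      using det_0_iff_vec_prod_zero_field[OF P] by blast
    then have "lin_comb n L (\<lambda>j. b $ j) = 0\<^sub>v n" using mat_of_cols_mult_vec L(2) by metis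
    then have "b = 0\<^sub>v n" using L(2) b(1) lin_indepD[OF L(3)] by (intro eq_vecI) auto
    with b(2) show False ..
  qed
  then have "det (mat_of_rows n L) \<noteq> 0"
    using det_transpose[OF P] by (simp add: transpose_mat_of_cols)
  moreover have "mat_of_rows n L *\<^sub>v z = 0\<^sub>v n"
  proof (rule eq_vecI)
    fix j assume "j < dim_vec (0\<^sub>v n :: 'a vec)"
    then have j: "j < n" by simp
    then have "L ! j \<in> carrier_vec n" using L by auto
    then show "(mat_of_rows n L *\<^sub>v z) $ j = 0\<^sub>v n $ j" using j L(2) orth by simp
  qed (use L(2) in simp)
  ultimately show ?thesis
    using det_0_iff_vec_prod_zero_field[of "mat_of_rows n L" n] L(2) z by auto
qed

lemma lin_indep_orthogonal_length_le:
  fixes xs zs :: "'a :: field vec list"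
  assumes xs: "set xs \<subseteq> carrier_vec n" "lin_indep n xs"
    and zs: "set zs \<subseteq> carrier_vec n" "lin_indep n zs"
    and orth: "\<And>i k. i < length xs \<Longrightarrow> k < length zs \<Longrightarrow> xs ! i \<bullet> zs ! k = 0"
  shows "length xs + length zs \<le> n"
proof -
  obtain es where es: "set es \<subseteq> carrier_vec n" "length xs + length es = n" "lin_indep n (xs @ es)"
    using lin_indep_extend[OF xs] .
  (* z \<mapsto> (e \<bullet> z) for e in es is injective on the span of zs: a vector orthogonal to the
     whole basis xs @ es is zero. *)
  define ws where "ws = map (\<lambda>k. vec (length es) (\<lambda>a. es ! a \<bullet> zs ! k)) [0..<length zs]"
  have "lin_indep (length es) ws"
    unfolding lin_indep_def
  proof (intro allI impI)
    fix d :: "nat \<Rightarrow> 'a" and k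
    assume d: "lin_comb (length es) ws d = 0\<^sub>v (length es)" and k: "k < length ws"
    have "lin_comb n zs d = 0\<^sub>v n"
    proof (rule orthogonal_to_basis_eq_zero[OF _ _ es(3)])
      fix j assume j: "j < n"
      show "(xs @ es) ! j \<bullet> lin_comb n zs d = 0"
      proof (cases "j < length xs")
        case True
        then have "xs ! j \<in> carrier_vec n" using xs(1) by auto
        then show ?thesis using True orth by (simp add: nth_append scalar_prod_lin_comb[OF _ zs(1)])
      next
        case False
        then have a: "j - length xs < length es" using j es(2) by linarith
        then have "es ! (j - length xs) \<in> carrier_vec n" using es(1) by auto
        then have "es ! (j - length xs) \<bullet> lin_comb n zs d = lin_comb (length es) ws d $ (j - length xs)"
          using a by (simp add: scalar_prod_lin_comb[OF _ zs(1)] ws_def)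
        then show ?thesis using False d a by (simp add: nth_append)
      qed
    qed (use xs es in auto)
    then show "d k = 0" using lin_indepD[OF zs(2)] k by (simp add: ws_def)
  qed
  then have "length ws \<le> length es" by (intro lin_indep_length_le) (auto simp: ws_def)
  then show ?thesis using es(2) by (simp add: ws_def)
qed

lemma invertible_mat_iff_trivial_kernel:
  fixes M :: "'a :: field mat"
  assumes M: "M \<in> carrier_mat n n"
  shows "invertible_mat M \<longleftrightarrow> (\<forall>w\<in>carrier_vec n. M *\<^sub>v w = 0\<^sub>v n \<longrightarrow> w = 0\<^sub>v n)"
proof
  assume "invertible_mat M"
  then obtain M' where M': "M' * M = 1\<^sub>m (dim_row M')" "M * M' = 1\<^sub>m (dim_row M)"
    unfolding invertible_mat_def inverts_mat_def by blast
  then have M'c: "M' \<in> carrier_mat n n" using M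
    by (metis carrier_matD carrier_matI index_mult_mat(2,3) index_one_mat(2,3))
  show "\<forall>w\<in>carrier_vec n. M *\<^sub>v w = 0\<^sub>v n \<longrightarrow> w = 0\<^sub>v n"
  proof (intro ballI impI)
    fix w :: "'a vec" assume w: "w \<in> carrier_vec n" and "M *\<^sub>v w = 0\<^sub>v n"
    then have "M' *\<^sub>v (M *\<^sub>v w) = 0\<^sub>v n" using M'c by (intro eq_vecI) auto
    then show "w = 0\<^sub>v n" using M' M'c M w by (metis assoc_mult_mat_vec carrier_matD(1) one_mult_mat_vec)
  qed
next
  assume "\<forall>w\<in>carrier_vec n. M *\<^sub>v w = 0\<^sub>v n \<longrightarrow> w = 0\<^sub>v n"
  then have "det M \<noteq> 0" using det_0_iff_vec_prod_zero_field[OF M] by blast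
  then have "M \<in> Units (ring_mat TYPE('a) n ())" by (rule det_non_zero_imp_unit[OF M])
  then show "invertible_mat M"
    using M unfolding Units_def invertible_mat_def inverts_mat_def by (auto simp: ring_mat_simps)
qed

lemma symmetric_right_inverse:
  fixes A S :: "'a :: comm_ring_1 mat"
  assumes A: "A \<in> carrier_mat n n" and S: "S \<in> carrier_mat n n"
    and sym: "transpose_mat A = A" and AS: "A * S = 1\<^sub>m n"
  shows "transpose_mat S = S"
proof -
  have "transpose_mat S * A = 1\<^sub>m n"
    using transpose_mult[OF A S] sym AS by simp
  have "transpose_mat S = transpose_mat S * (A * S)" using S AS by simp
  also have "\<dots> = (transpose_mat S * A) * S" using A S by (simp add: assoc_mult_mat)
  also have "\<dots> = S" using \<open>transpose_mat S * A = 1\<^sub>m n\<close> S by simp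
  finally show ?thesis .
qed

lemma scalar_prod_symmetric_mat:
  fixes S :: "'a :: comm_ring_1 mat"
  assumes S: "S \<in> carrier_mat n n" and sym: "transpose_mat S = S"
    and x: "x \<in> carrier_vec n" and y: "y \<in> carrier_vec n"
  shows "x \<bullet> (S *\<^sub>v y) = y \<bullet> (S *\<^sub>v x)"
  using transpose_vec_mult_scalar[OF S y x] comm_scalar_prod[OF y mult_mat_vec_carrier[OF S x]] sym
  by simp

lemma mult_mat_vec_zero [simp]: "A \<in> carrier_mat nr nc \<Longrightarrow> A *\<^sub>v 0\<^sub>v nc = 0\<^sub>v nr"
  by (intro eq_vecI) auto

lemma lin_indep_map_mult_mat:
  assumes S: "S \<in> carrier_mat m n"
    and inj: "\<And>y. y \<in> carrier_vec n \<Longrightarrow> S *\<^sub>v y = 0\<^sub>v m \<Longrightarrow> y = 0\<^sub>v n"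
    and vs: "set vs \<subseteq> carrier_vec n" "lin_indep n vs"
  shows "lin_indep m (map ((*\<^sub>v) S) vs)"
  unfolding lin_indep_def
proof (intro allI impI)
  fix d k assume "lin_comb m (map ((*\<^sub>v) S) vs) d = 0\<^sub>v m" and k: "k < length (map ((*\<^sub>v) S) vs)"
  then have "lin_comb n vs d = 0\<^sub>v n" using inj mult_mat_vec_lin_comb[OF S vs(1)] by simp
  then show "d k = 0" using lin_indepD[OF vs(2)] k by simp
qed

lemma form_orthogonal_length_le:
  fixes S :: "'a :: field mat"
  assumes S: "S \<in> carrier_mat n n" "invertible_mat S"
    and xs: "set xs \<subseteq> carrier_vec n" "lin_indep n xs"
    and ys: "set ys \<subseteq> carrier_vec n" "lin_indep n ys"
    and orth: "\<And>i k. i < length xs \<Longrightarrow> k < length ys \<Longrightarrow> xs ! i \<bullet> (S *\<^sub>v ys ! k) = 0"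
  shows "length xs + length ys \<le> n"
proof -
  have "set (map ((*\<^sub>v) S) ys) \<subseteq> carrier_vec n" using S(1) ys(1) by (auto intro: mult_mat_vec_carrier)
  moreover have "lin_indep n (map ((*\<^sub>v) S) ys)"
    using lin_indep_map_mult_mat[OF S(1) _ ys] invertible_mat_iff_trivial_kernel[OF S(1)] S(2) by blast
  ultimately have "length xs + length (map ((*\<^sub>v) S) ys) \<le> n"
    using orth by (intro lin_indep_orthogonal_length_le[OF xs]) simp_all
  then show ?thesis by simp
qed

section \<open>Rank and arithmetic over the binary field\<close>

lemma rank_ge_length_lin_indep_cols:
  fixes M :: "'a :: field mat"
  assumes M: "M \<in> carrier_mat d nc" and sub: "set vs \<subseteq> set (cols M)" and ind: "lin_indep d vs"
  shows "length vs \<le> vec_space.rank d M"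
proof -
  interpret V: vec_space "TYPE('a)" d .
  have vs: "set vs \<subseteq> carrier_vec d" using sub M by (auto simp: cols_def)
  have dist: "distinct vs" by (rule lin_indep_distinct[OF ind])
  have "V.lin_indpt (set vs)" using lin_indpt_iff_lin_indep[OF vs dist] ind by simp
  then have "card (set vs) \<le> V.rank M" by (rule V.rank_ge_card_indpt[OF M sub])
  then show ?thesis using distinct_card[OF dist] by simp
qed

lemma lin_indep_single:
  fixes v :: "'a :: field vec"
  assumes v: "v \<in> carrier_vec d" "v \<noteq> 0\<^sub>v d"
  shows "lin_indep d [v]"
  unfolding lin_indep_def
proof (intro allI impI)
  fix c :: "nat \<Rightarrow> 'a" and k assume c: "lin_comb d [v] c = 0\<^sub>v d" and k: "k < length [v]"
  show "c k = 0"
  proof (rule ccontr)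
    assume "c k \<noteq> 0"
    then have "c 0 \<noteq> 0" using k by simp
    moreover have "c 0 * v $ a = 0" if "a < d" for a
      using arg_cong[OF c, of "\<lambda>w. w $ a"] that by simp
    ultimately have "v = 0\<^sub>v d" using v(1) by (intro eq_vecI) auto
    with v(2) show False ..
  qed
qed

lemma bit_add_eq_0_iff: "(x :: bit) + y = 0 \<longleftrightarrow> x = y"
  by (cases x; cases y) simp_all

lemma sum_add_const_even:
  fixes f :: "nat \<Rightarrow> bit"
  assumes "even r"
  shows "(\<Sum>i<r. f i + c) = (\<Sum>i<r. f i)"
proof -
  have "(of_nat r :: bit) = 0" using assms by (elim evenE) simp
  then show ?thesis by (simp add: sum.distrib)
qed

lemma bit_vec_add_eq_0_iff:
  fixes v w :: "bit vec"
  assumes "v \<in> carrier_vec n" "w \<in> carrier_vec n"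
  shows "v + w = 0\<^sub>v n \<longleftrightarrow> v = w"
proof
  assume vw: "v + w = 0\<^sub>v n"
  have "v $ i + w $ i = 0" if "i < n" for i
    using arg_cong[OF vw, of "\<lambda>u. u $ i"] that assms by simp
  then show "v = w" using assms by (intro eq_vecI) (auto simp: bit_add_eq_0_iff)
qed (use assms in \<open>auto intro!: eq_vecI\<close>)

lemma lin_indep_pair_bit:
  fixes u v :: "bit vec"
  assumes u: "u \<in> carrier_vec d" "u \<noteq> 0\<^sub>v d" and v: "v \<in> carrier_vec d" "v \<noteq> 0\<^sub>v d"
    and ne: "u \<noteq> v"
  shows "lin_indep d [u, v]"
  unfolding lin_indep_def
proof (intro allI impI)
  fix c :: "nat \<Rightarrow> bit" and k assume c: "lin_comb d [u, v] c = 0\<^sub>v d" and k: "k < length [u, v]"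
  have comp: "c 0 * u $ a + c 1 * v $ a = 0" if "a < d" for a
    using arg_cong[OF c, of "\<lambda>w. w $ a"] that by (simp add: numeral_2_eq_2)
  have "c 0 = 0 \<and> c 1 = 0"
  proof (cases "c 0"; cases "c 1")
    assume "c 0 = 1" "c 1 = 0"
    then have "u = 0\<^sub>v d" using comp u(1) by (intro eq_vecI) auto
    with u(2) show ?thesis ..
  next
    assume "c 0 = 0" "c 1 = 1"
    then have "v = 0\<^sub>v d" using comp v(1) by (intro eq_vecI) auto
    with v(2) show ?thesis ..
  next
    assume "c 0 = 1" "c 1 = 1"
    then have "u = v" using comp u(1) v(1) by (intro eq_vecI) (auto simp: bit_add_eq_0_iff)
    with ne show ?thesis ..
  qed simp
  then show "c k = 0" using k by (auto simp: less_Suc_eq)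
qed

lemma rank_ge_1:
  fixes M :: "'a :: field mat"
  assumes M: "M \<in> carrier_mat d nc" and j: "j < nc" and nz: "col M j \<noteq> 0\<^sub>v d"
  shows "1 \<le> vec_space.rank d M"
  using rank_ge_length_lin_indep_cols[OF M _ lin_indep_single[OF _ nz], of] M j
  by (simp add: cols_def)

lemma rank_ge_2_bit:
  fixes M :: "bit mat"
  assumes M: "M \<in> carrier_mat d nc" and ij: "i < nc" "j < nc"
    and nz: "col M i \<noteq> 0\<^sub>v d" "col M j \<noteq> 0\<^sub>v d" and ne: "col M i \<noteq> col M j"
  shows "2 \<le> vec_space.rank d M"
  using rank_ge_length_lin_indep_cols[OF M _ lin_indep_pair_bit[OF _ nz(1) _ nz(2) ne]] M ij
  by (simp add: cols_def)

lemma exists_nonzero_col: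
  fixes M :: "'a :: field mat"
  assumes M: "M \<in> carrier_mat d nc" and rk: "vec_space.rank d M \<noteq> 0"
  shows "\<exists>j<nc. col M j \<noteq> 0\<^sub>v d"
proof (rule ccontr)
  assume "\<not> (\<exists>j<nc. col M j \<noteq> 0\<^sub>v d)"
  then have "col M j $ i = 0" if "i < d" "j < nc" for i j using that by simp
  then have "M $$ (i, j) = 0" if "i < d" "j < nc" for i j using that M by simp
  then have "M = 0\<^sub>m d nc" using M by (intro eq_matI) auto
  then show False using rk by (simp add: vec_space.rank_0I)
qed

lemma rank_one_symmetric_bit:
  fixes M :: "bit mat"
  assumes M: "M \<in> carrier_mat d d"
    and sym: "\<And>i j. i < d \<Longrightarrow> j < d \<Longrightarrow> M $$ (i, j) = M $$ (j, i)"
    and rk: "vec_space.rank d M = 1"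
  obtains v where "\<exists>q<d. v q = 1" "\<And>i j. i < d \<Longrightarrow> j < d \<Longrightarrow> M $$ (i, j) = v i * v j"
proof -
  obtain q where q: "q < d" "col M q \<noteq> 0\<^sub>v d" using exists_nonzero_col[OF M] rk by auto
  have col: "col M j = 0\<^sub>v d \<or> col M j = col M q" if "j < d" for j
    using rank_ge_2_bit[OF M that q(1) _ q(2)] rk by linarith
  have entry: "M $$ (i, j) = col M j $ i" if "i < d" "j < d" for i j
    using that M by simp
  define v where "v i = M $$ (q, i)" for i
  have "v q = 1"
  proof (rule ccontr)
    assume "v q \<noteq> 1"
    then have Mqq: "M $$ (q, q) = 0" by (simp add: v_def)
    have "M $$ (i, q) = 0" if i: "i < d" for i
    proof -
      have "M $$ (i, q) = col M i $ q" using sym[OF i q(1)] entry[OF q(1) i] by simp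
      also have "\<dots> = 0" using col[OF i] entry[OF q(1) q(1)] Mqq q(1) by auto
      finally show ?thesis .
    qed
    then have "col M q = 0\<^sub>v d" using M q(1) by (intro eq_vecI) auto
    with q(2) show False ..
  qed
  have "M $$ (i, j) = v i * v j" if ij: "i < d" "j < d" for i j
  proof (cases "col M j = 0\<^sub>v d")
    case True
    then show ?thesis using entry[OF ij] entry[OF q(1) ij(2)] ij q(1) by (simp add: v_def)
  next
    case False
    then have "col M j = col M q" using col[OF ij(2)] by simp
    then show ?thesis
      using entry[OF ij] entry[OF q(1) ij(2)] entry[OF ij(1) q(1)] entry[OF q(1) q(1)] sym[OF ij(1) q(1)]
        \<open>v q = 1\<close> by (simp add: v_def)
  qed
  then show ?thesis using that q(1) \<open>v q = 1\<close> by blast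
qed

section \<open>The Gram matrix of the extended family and invertibility of B\<close>

definition gram_entry :: "'a :: comm_semiring_0 mat \<Rightarrow> 'a vec list \<Rightarrow> nat \<Rightarrow> nat \<Rightarrow> 'a" where
  "gram_entry S xs i j = xs ! i \<bullet> (S *\<^sub>v xs ! j)"

definition bordered ::
  "(nat \<Rightarrow> nat \<Rightarrow> 'a :: comm_monoid_add) \<Rightarrow> nat \<Rightarrow> nat \<Rightarrow> nat \<Rightarrow> 'a" where
  "bordered G r i j =
    (if i < r \<and> j < r then G i j
     else if i < r then (\<Sum>l<r. G i l)
     else if j < r then (\<Sum>k<r. G k j)
     else (\<Sum>k<r. \<Sum>l<r. G k l))"

(* G + I + J is nonsingular on F_2^r, where J is the all-ones matrix: the premise on u says
   (G + I + J) u = 0. *)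
definition shifted_nonsingular :: "(nat \<Rightarrow> nat \<Rightarrow> bit) \<Rightarrow> nat \<Rightarrow> bool" where
  "shifted_nonsingular G r \<longleftrightarrow>
    (\<forall>u. (\<forall>i<r. (\<Sum>j<r. G i j * u j) = u i + (\<Sum>j<r. u j)) \<longrightarrow> (\<forall>i<r. u i = 0))"

lemma ext_family_eq: "ext_family n xs = xs @ [lin_comb n xs (\<lambda>_. 1)]"
  by (simp add: ext_family_def lin_comb_def)

lemma length_ext_family [simp]: "length (ext_family n xs) = Suc (length xs)"
  by (simp add: ext_family_eq)

lemma ext_family_carrier: "set xs \<subseteq> carrier_vec n \<Longrightarrow> set (ext_family n xs) \<subseteq> carrier_vec n"
  by (simp add: ext_family_eq)

lemma gram_entry_symmetric:
  fixes S :: "'a :: comm_ring_1 mat"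
  assumes "S \<in> carrier_mat n n" "transpose_mat S = S" "set xs \<subseteq> carrier_vec n"
    and "i < length xs" "j < length xs"
  shows "gram_entry S xs i j = gram_entry S xs j i"
proof -
  have "xs ! i \<in> carrier_vec n" "xs ! j \<in> carrier_vec n" using assms(3-5) by auto
  then show ?thesis unfolding gram_entry_def by (rule scalar_prod_symmetric_mat[OF assms(1,2)])
qed

lemma gram_ext_family:
  assumes S: "S \<in> carrier_mat n n" and xs: "set xs \<subseteq> carrier_vec n"
    and ij: "i \<le> length xs" "j \<le> length xs"
  shows "gram S (ext_family n xs) $$ (i, j) = bordered (gram_entry S xs) (length xs) i j"
proof -
  define r where "r = length xs"
  define s where "s = lin_comb n xs (\<lambda>_. 1)"
  have x: "xs ! k \<in> carrier_vec n" if "k < r" for k using xs that by (auto simp: r_def)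
  have y: "ext_family n xs ! k = (if k < r then xs ! k else s)" if "k \<le> r" for k
    using that by (simp add: ext_family_eq s_def r_def nth_append)
  have right: "u \<bullet> (S *\<^sub>v s) = (\<Sum>l<r. u \<bullet> (S *\<^sub>v xs ! l))" if "u \<in> carrier_vec n" for u
    unfolding s_def r_def by (simp add: scalar_prod_mult_lin_comb[OF S xs that])
  have left: "s \<bullet> w = (\<Sum>k<r. xs ! k \<bullet> w)" if "w \<in> carrier_vec n" for w
    unfolding s_def r_def by (simp add: lin_comb_scalar_prod[OF that xs])
  have Sv: "S *\<^sub>v v \<in> carrier_vec n" for v using S by (simp add: carrier_vecI)
  have "gram S (ext_family n xs) $$ (i, j) = ext_family n xs ! i \<bullet> (S *\<^sub>v ext_family n xs ! j)"
    using ij by (simp add: gram_def)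
  also have "\<dots> = bordered (gram_entry S xs) r i j"
  proof (cases "i < r"; cases "j < r")
    assume "i < r" "\<not> j < r"
    then show ?thesis using ij y right[OF x] by (simp add: bordered_def gram_entry_def r_def)
  next
    assume "\<not> i < r" "j < r"
    then show ?thesis using ij y left[OF Sv] by (simp add: bordered_def gram_entry_def r_def)
  next
    assume "\<not> i < r" "\<not> j < r"
    then show ?thesis using ij y left[OF Sv] right[OF x]
      by (simp add: bordered_def gram_entry_def r_def)
  qed (use ij y in \<open>simp add: bordered_def gram_entry_def\<close>)
  finally show ?thesis by (simp add: r_def)
qed

lemma sum_outer_carrier [simp]:
  "sum_outer n ys \<in> carrier_mat n n" "dim_row (sum_outer n ys) = n" "dim_col (sum_outer n ys) = n"
  by (simp_all add: sum_outer_def)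

lemma sum_outer_mult_vec:
  assumes ys: "set ys \<subseteq> carrier_vec n" and w: "w \<in> carrier_vec n"
  shows "sum_outer n ys *\<^sub>v w = lin_comb n ys (\<lambda>i. ys ! i \<bullet> w)"
proof (rule eq_vecI)
  fix a assume "a < dim_vec (lin_comb n ys (\<lambda>i. ys ! i \<bullet> w))"
  then have a: "a < n" by simp
  have "(sum_outer n ys *\<^sub>v w) $ a = (\<Sum>b<n. \<Sum>i<length ys. ys ! i $ a * (ys ! i $ b * w $ b))"
    using a w by (simp add: sum_outer_def scalar_prod_def row_def atLeast0LessThan
        sum_distrib_right mult.assoc)
  also have "\<dots> = (\<Sum>i<length ys. \<Sum>b<n. ys ! i $ a * (ys ! i $ b * w $ b))"
    by (rule sum.swap)
  also have "\<dots> = (\<Sum>i<length ys. (ys ! i \<bullet> w) * ys ! i $ a)"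
    using w by (simp add: scalar_prod_def atLeast0LessThan sum_distrib_left mult.commute)
  finally show "(sum_outer n ys *\<^sub>v w) $ a = lin_comb n ys (\<lambda>i. ys ! i \<bullet> w) $ a"
    using a by simp
qed (simp add: sum_outer_def)

lemma sum_outer_ext_family_mult_vec:
  assumes xs: "set xs \<subseteq> carrier_vec n" and w: "w \<in> carrier_vec n"
  shows "sum_outer n (ext_family n xs) *\<^sub>v w
       = lin_comb n xs (\<lambda>i. xs ! i \<bullet> w + (\<Sum>j<length xs. xs ! j \<bullet> w))"
proof -
  define s where "s = lin_comb n xs (\<lambda>_. 1)"
  have sw: "s \<bullet> w = (\<Sum>j<length xs. xs ! j \<bullet> w)"
    unfolding s_def by (simp add: lin_comb_scalar_prod[OF w xs])
  have "sum_outer n (ext_family n xs) *\<^sub>v w = lin_comb n (xs @ [s]) (\<lambda>i. (xs @ [s]) ! i \<bullet> w)"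
    using sum_outer_mult_vec[OF ext_family_carrier[OF xs] w] by (simp add: ext_family_eq s_def)
  also have "\<dots> = lin_comb n xs (\<lambda>i. (xs @ [s]) ! i \<bullet> w + (xs @ [s]) ! length xs \<bullet> w * 1)"
    unfolding s_def by (rule lin_comb_snoc_lin_comb)
  also have "\<dots> = lin_comb n xs (\<lambda>i. xs ! i \<bullet> w + (\<Sum>j<length xs. xs ! j \<bullet> w))"
    using sw by (intro lin_comb_cong) (simp add: nth_append)
  finally show ?thesis .
qed

lemma configD:
  assumes "config n r A B S xs"
  shows "A \<in> carrier_mat n n" "S \<in> carrier_mat n n" "transpose_mat S = S"
    "S * A = 1\<^sub>m n" "A * S = 1\<^sub>m n" "set xs \<subseteq> carrier_vec n" "lin_indep n xs" "length xs = r"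
    "B = A + sum_outer n (ext_family n xs)" "invertible_mat B" "invertible_mat S"
proof -
  note c = assms[unfolded config_def SGL_def lin_indep_list_iff]
  show A: "A \<in> carrier_mat n n" and S: "S \<in> carrier_mat n n" and "S * A = 1\<^sub>m n" "A * S = 1\<^sub>m n"
    "set xs \<subseteq> carrier_vec n" "lin_indep n xs" "length xs = r" "invertible_mat B"
    using c by auto
  show "transpose_mat S = S" using symmetric_right_inverse[OF A S] c by blast
  show "invertible_mat S"
    using A S c unfolding invertible_mat_def inverts_mat_def by (auto simp: carrier_matD)
  have B: "B \<in> carrier_mat n n" and BA: "B - A = sum_outer n (ext_family n xs)" using c by auto
  have "B = A + (B - A)" using A B by (intro eq_matI) (auto simp del: minus_bit_def)
  then show "B = A + sum_outer n (ext_family n xs)" unfolding BA .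
qed

lemma configI:
  fixes A S :: "bit mat"
  assumes A: "A \<in> carrier_mat n n" "transpose_mat A = A"
    and S: "S \<in> carrier_mat n n" "A * S = 1\<^sub>m n" "S * A = 1\<^sub>m n"
    and xs: "set xs \<subseteq> carrier_vec n" "lin_indep n xs" "length xs = r"
    and B: "invertible_mat (A + sum_outer n (ext_family n xs))"
  shows "config n r A (A + sum_outer n (ext_family n xs)) S xs"
proof -
  let ?C = "sum_outer n (ext_family n xs)"
  have "invertible_mat A"
    using A S unfolding invertible_mat_def inverts_mat_def by (auto simp: carrier_matD)
  moreover have "transpose_mat ?C = ?C" by (rule eq_matI) (auto simp: sum_outer_def mult.commute)
  then have "transpose_mat (A + ?C) = A + ?C" using A by (simp add: transpose_add)
  moreover have "(A + ?C) - A = ?C" using A by (intro eq_matI) auto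
  ultimately show ?thesis
    using A S xs B unfolding config_def SGL_def lin_indep_list_iff by auto
qed

lemma add_sum_outer_mult_lin_comb:
  fixes A S :: "bit mat"
  assumes A: "A \<in> carrier_mat n n" and S: "S \<in> carrier_mat n n" and AS: "A * S = 1\<^sub>m n"
    and xs: "set xs \<subseteq> carrier_vec n"
  defines "r \<equiv> length xs" and "G \<equiv> gram_entry S xs"
  shows "(A + sum_outer n (ext_family n xs)) *\<^sub>v (S *\<^sub>v lin_comb n xs u)
    = lin_comb n xs (\<lambda>i. u i + (\<Sum>j<r. G i j * u j) + (\<Sum>k<r. \<Sum>j<r. G k j * u j))"
proof -
  let ?w = "S *\<^sub>v lin_comb n xs u"
  have w: "?w \<in> carrier_vec n" using S by simp
  have t: "xs ! i \<bullet> ?w = (\<Sum>j<r. G i j * u j)" if "i < r" for i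
  proof -
    have "xs ! i \<in> carrier_vec n" using that xs by (auto simp: r_def)
    from scalar_prod_mult_lin_comb[OF S xs this] show ?thesis
      by (simp add: G_def gram_entry_def r_def mult.commute)
  qed
  have "A *\<^sub>v ?w = lin_comb n xs u" using A S AS by (simp flip: assoc_mult_mat_vec)
  moreover have "sum_outer n (ext_family n xs) *\<^sub>v ?w
      = lin_comb n xs (\<lambda>i. (\<Sum>j<r. G i j * u j) + (\<Sum>k<r. \<Sum>j<r. G k j * u j))"
    unfolding sum_outer_ext_family_mult_vec[OF xs w] using t
    by (intro lin_comb_cong) (simp add: r_def)
  ultimately show ?thesis
    using A w by (simp add: add_mult_distrib_mat_vec lin_comb_add add.assoc)
qed

lemma invertible_imp_shifted_nonsingular:
  fixes A S :: "bit mat"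
  assumes A: "A \<in> carrier_mat n n" and S: "S \<in> carrier_mat n n" and AS: "A * S = 1\<^sub>m n"
    and xs: "set xs \<subseteq> carrier_vec n" "lin_indep n xs" and ev: "even (length xs)"
    and B: "invertible_mat (A + sum_outer n (ext_family n xs))"
  shows "shifted_nonsingular (gram_entry S xs) (length xs)"
  unfolding shifted_nonsingular_def
proof (intro allI impI)
  fix u :: "nat \<Rightarrow> bit" and i
  let ?r = "length xs" and ?G = "gram_entry S xs"
  assume h: "\<forall>i<?r. (\<Sum>j<?r. ?G i j * u j) = u i + (\<Sum>j<?r. u j)" and i: "i < ?r"
  then have "(\<Sum>k<?r. \<Sum>j<?r. ?G k j * u j) = (\<Sum>j<?r. u j)"
    using sum_add_const_even[OF ev] by simp
  then have "(A + sum_outer n (ext_family n xs)) *\<^sub>v (S *\<^sub>v lin_comb n xs u) = lin_comb n xs (\<lambda>_. 0)"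
    unfolding add_sum_outer_mult_lin_comb[OF A S AS xs(1)] using h by (intro lin_comb_cong) simp
  then have Bw: "(A + sum_outer n (ext_family n xs)) *\<^sub>v (S *\<^sub>v lin_comb n xs u) = 0\<^sub>v n"
    by (simp add: lin_comb_zero_coeffs)
  have "A + sum_outer n (ext_family n xs) \<in> carrier_mat n n" using A by simp
  from invertible_mat_iff_trivial_kernel[OF this] B Bw
  have "S *\<^sub>v lin_comb n xs u = 0\<^sub>v n" using S by simp
  moreover have "lin_comb n xs u = A *\<^sub>v (S *\<^sub>v lin_comb n xs u)"
    using A S AS by (simp flip: assoc_mult_mat_vec)
  ultimately show "u i = 0" using lin_indepD[OF xs(2)] i A by simp
qed

lemma add_sum_outer_kernel:
  fixes A S :: "bit mat"
  assumes A: "A \<in> carrier_mat n n" and S: "S \<in> carrier_mat n n" and SA: "S * A = 1\<^sub>m n"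
    and xs: "set xs \<subseteq> carrier_vec n"
    and w: "w \<in> carrier_vec n" and Bw: "(A + sum_outer n (ext_family n xs)) *\<^sub>v w = 0\<^sub>v n"
  obtains u where "w = S *\<^sub>v lin_comb n xs u"
proof -
  define u where "u i = xs ! i \<bullet> w + (\<Sum>j<length xs. xs ! j \<bullet> w)" for i
  have "sum_outer n (ext_family n xs) *\<^sub>v w = lin_comb n xs u"
    unfolding u_def by (rule sum_outer_ext_family_mult_vec[OF xs w])
  then have "A *\<^sub>v w + lin_comb n xs u = 0\<^sub>v n"
    using Bw A w by (simp add: add_mult_distrib_mat_vec)
  then have Aw: "A *\<^sub>v w = lin_comb n xs u" using A w by (simp add: bit_vec_add_eq_0_iff)
  have "w = (S * A) *\<^sub>v w" using SA w by simp
  then have "w = S *\<^sub>v lin_comb n xs u" using A S w by (simp add: Aw)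
  then show ?thesis by (rule that)
qed

lemma shifted_nonsingular_imp_invertible:
  fixes A S :: "bit mat"
  assumes A: "A \<in> carrier_mat n n" and S: "S \<in> carrier_mat n n"
    and SA: "S * A = 1\<^sub>m n" and AS: "A * S = 1\<^sub>m n"
    and xs: "set xs \<subseteq> carrier_vec n" "lin_indep n xs" and ev: "even (length xs)"
    and ns: "shifted_nonsingular (gram_entry S xs) (length xs)"
  shows "invertible_mat (A + sum_outer n (ext_family n xs))"
proof -
  define r where "r = length xs"
  define B where "B = A + sum_outer n (ext_family n xs)"
  define G where "G = gram_entry S xs"
  have "w = 0\<^sub>v n" if w: "w \<in> carrier_vec n" and Bw: "B *\<^sub>v w = 0\<^sub>v n" for w
  proof -
    obtain u where wu: "w = S *\<^sub>v lin_comb n xs u"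
      using add_sum_outer_kernel[OF A S SA xs(1) w] Bw by (auto simp: B_def)
    define t where "t i = (\<Sum>j<r. G i j * u j)" for i
    have "lin_comb n xs (\<lambda>i. u i + t i + (\<Sum>k<r. t k)) = 0\<^sub>v n"
      using Bw add_sum_outer_mult_lin_comb[OF A S AS xs(1), of u] wu
      by (simp add: t_def B_def G_def r_def)
    then have coeff: "u i + t i + (\<Sum>k<r. t k) = 0" if "i < r" for i
      using lin_indepD[OF xs(2)] that by (simp add: r_def)
    have ti: "t i = u i + (\<Sum>k<r. t k)" if "i < r" for i
      using coeff[OF that] by (cases "u i"; cases "t i"; cases "\<Sum>k<r. t k") simp_all
    have "(\<Sum>k<r. t k) = (\<Sum>k<r. u k + (\<Sum>k<r. t k))"
      by (intro sum.cong refl) (rule ti, simp)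
    also have "\<dots> = (\<Sum>k<r. u k)" by (rule sum_add_const_even[OF ev[folded r_def]])
    finally have sum_t: "(\<Sum>k<r. t k) = (\<Sum>k<r. u k)" .
    have "(\<Sum>j<r. G i j * u j) = u i + (\<Sum>j<r. u j)" if "i < r" for i
      using ti[OF that] unfolding sum_t by (simp add: t_def)
    then have "\<forall>i<r. u i = 0" using ns unfolding shifted_nonsingular_def G_def r_def by blast
    then have "lin_comb n xs u = 0\<^sub>v n"
      by (simp add: lin_comb_cong[of xs u "\<lambda>_. 0"] lin_comb_zero_coeffs r_def)
    then show ?thesis using wu S by simp
  qed
  then show ?thesis using invertible_mat_iff_trivial_kernel[of B n] A by (simp add: B_def)
qed

section \<open>Necessary conditions\<close>

lemma shifted_nonsingular_two:
  assumes ns: "shifted_nonsingular G 2" and sym: "G 1 0 = G 0 1"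
  shows "G 0 1 = G 0 0 * G 1 1"
proof -
  have kernel: "u 0 = 0 \<and> u 1 = 0"
    if "G 0 0 * u 0 + G 0 1 * u 1 = u 1" "G 1 0 * u 0 + G 1 1 * u 1 = u 0" for u :: "nat \<Rightarrow> bit"
  proof -
    have "(\<Sum>j<2. G i j * u j) = u i + (\<Sum>j<2. u j)" if "i < 2" for i
    proof -
      from that consider "i = 0" | "i = 1" by linarith
      then show ?thesis using \<open>G 0 0 * u 0 + G 0 1 * u 1 = u 1\<close> \<open>G 1 0 * u 0 + G 1 1 * u 1 = u 0\<close>
        by cases (simp_all add: numeral_2_eq_2 add.assoc[symmetric])
    qed
    then have "\<forall>i<2. u i = 0" using ns unfolding shifted_nonsingular_def by blast
    then show ?thesis by simp
  qed
  have "G 0 0 = 0 \<Longrightarrow> G 0 1 = 1 \<Longrightarrow> False"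
    using kernel[of "\<lambda>i. if i = 0 then 1 else 0"] sym by simp
  moreover have "G 1 1 = 0 \<Longrightarrow> G 0 1 = 1 \<Longrightarrow> False"
    using kernel[of "\<lambda>i. if i = 0 then 0 else 1"] sym by simp
  moreover have "G 0 0 + G 0 1 = 1 \<Longrightarrow> G 0 1 + G 1 1 = 1 \<Longrightarrow> False"
    using kernel[of "\<lambda>_. 1"] sym by simp
  ultimately show ?thesis
    by (cases "G 0 0"; cases "G 0 1"; cases "G 1 1") simp_all
qed

lemma gram_rank_one_factor:
  fixes S :: "bit mat"
  assumes S: "S \<in> carrier_mat n n" "transpose_mat S = S" and xs: "set xs \<subseteq> carrier_vec n"
    and rk: "vec_space.rank (length xs + 1) (gram S (ext_family n xs)) = 1"
  obtains v p where "p < length xs" "v p = 1"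
    "\<And>i j. i < length xs \<Longrightarrow> j < length xs \<Longrightarrow> gram_entry S xs i j = v i * v j"
proof -
  define r where "r = length xs"
  define M where "M = gram S (ext_family n xs)"
  have M: "M \<in> carrier_mat (r + 1) (r + 1)" by (simp add: M_def gram_def r_def)
  have M_entry: "M $$ (i, j) = bordered (gram_entry S xs) r i j" if "i \<le> r" "j \<le> r" for i j
    using gram_ext_family[OF S(1) xs] that by (simp add: M_def r_def)
  have "M $$ (i, j) = M $$ (j, i)" if "i < r + 1" "j < r + 1" for i j
    using gram_entry_symmetric[OF S ext_family_carrier[OF xs], of i j] that
    by (simp add: M_def gram_def gram_entry_def r_def)
  then obtain v where v: "\<exists>q<r + 1. v q = 1"
      "\<And>i j. i < r + 1 \<Longrightarrow> j < r + 1 \<Longrightarrow> M $$ (i, j) = v i * v j"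
    using rank_one_symmetric_bit[OF M] rk by (metis M_def r_def)
  have G: "gram_entry S xs i j = v i * v j" if "i < r" "j < r" for i j
    using M_entry[of i j] v(2)[of i j] that by (simp add: bordered_def)
  have "\<exists>p<r. v p = 1"
  proof (rule ccontr)
    assume "\<not> (\<exists>p<r. v p = 1)"
    then have "gram_entry S xs i j = 0" if "i < r" "j < r" for i j using G[OF that] that by auto
    then have "bordered (gram_entry S xs) r i i = 0" for i by (simp add: bordered_def)
    moreover obtain q where "q < r + 1" "v q = 1" using v(1) by blast
    ultimately show False using M_entry[of q q] v(2)[of q q] by simp
  qed
  then show ?thesis using that G by (auto simp: r_def)
qed

lemma rank_one_orthogonal_family:
  fixes S :: "bit mat"
  assumes S: "S \<in> carrier_mat n n" and xs: "set xs \<subseteq> carrier_vec n" "lin_indep n xs"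
    and p: "p < length xs" "v p = 1"
    and G: "\<And>i j. i < length xs \<Longrightarrow> j < length xs \<Longrightarrow> gram_entry S xs i j = v i * v j"
  obtains ys where "set ys \<subseteq> carrier_vec n" "lin_indep n ys" "length ys = length xs - 1"
    "\<And>i k. i < length xs \<Longrightarrow> k < length ys \<Longrightarrow> xs ! i \<bullet> (S *\<^sub>v ys ! k) = 0"
proof -
  define r where "r = length xs"
  define idx where "idx k = (if k < p then k else Suc k)" for k
  have idx: "idx k < r" "idx k \<noteq> p" if "k < r - 1" for k
    using that p(1) by (auto simp: idx_def r_def)
  have idx_inj: "idx k = idx k' \<longleftrightarrow> k = k'" for k k'
    by (auto simp: idx_def)
  (* The vectors x_j + v_j x_p for j \<noteq> p; the k-th of them has pivot idx k. *)
  define coef where "coef k j = (if j = idx k then 1 else 0) + (if j = p then v (idx k) else 0)" for k j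
  define ys where "ys = map (\<lambda>k. lin_comb n xs (coef k)) [0..<r - 1]"
  have carrier: "set ys \<subseteq> carrier_vec n" and len: "length ys = length xs - 1"
    by (auto simp: ys_def r_def)
  have indep: "lin_indep n ys"
    unfolding ys_def using idx by (intro lin_indep_pivot_lin_combs[OF xs(2)]) (auto simp: coef_def idx_inj r_def)
  have orth: "xs ! i \<bullet> (S *\<^sub>v ys ! k) = 0" if i: "i < length xs" and k: "k < length ys" for i k
  proof -
    have k': "k < r - 1" using k by (simp add: ys_def)
    have "xs ! i \<in> carrier_vec n" using xs(1) i by auto
    then have "xs ! i \<bullet> (S *\<^sub>v ys ! k) = (\<Sum>j<r. coef k j * gram_entry S xs i j)"
      using k' by (simp add: ys_def scalar_prod_mult_lin_comb[OF S xs(1)] gram_entry_def r_def)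
    also have "\<dots> = (\<Sum>j<r. (if j = idx k then gram_entry S xs i j else 0)
        + (if j = p then v (idx k) * gram_entry S xs i j else 0))"
      by (intro sum.cong refl) (simp add: coef_def distrib_right)
    also have "\<dots> = gram_entry S xs i (idx k) + v (idx k) * gram_entry S xs i p"
      using idx(1)[OF k'] p(1) by (simp add: sum.distrib r_def)
    also have "\<dots> = 0" using G[of i "idx k"] G[of i p] i idx(1)[OF k'] p by (simp add: r_def)
    finally show ?thesis .
  qed
  show ?thesis by (rule that[OF carrier indep len orth])
qed

lemma config_gram_rank_one_bound:
  assumes cf: "config n r A B S xs"
    and rk: "vec_space.rank (r + 1) (gram S (ext_family n xs)) = 1"
  shows "2 * r \<le> n + 1"
proof -
  note c = configD[OF cf]
  obtain v p where "p < r" "v p = 1"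
    "\<And>i j. i < r \<Longrightarrow> j < r \<Longrightarrow> gram_entry S xs i j = v i * v j"
    using gram_rank_one_factor[OF c(2,3,6)] rk c(8) by metis
  then obtain ys where "set ys \<subseteq> carrier_vec n" "lin_indep n ys" "length ys = r - 1"
    "\<And>i k. i < r \<Longrightarrow> k < length ys \<Longrightarrow> xs ! i \<bullet> (S *\<^sub>v ys ! k) = 0"
    using rank_one_orthogonal_family[OF c(2,6,7)] c(8) by metis
  then have "length xs + length ys \<le> n"
    using form_orthogonal_length_le[OF c(2,11,6,7)] c(8) by metis
  then show ?thesis using c(8) \<open>length ys = r - 1\<close> by simp
qed

lemma config_two_gram_rank_one:
  assumes cf: "config n 2 A B S xs" and n: "n \<le> 3"
  shows "vec_space.rank 3 (gram S (ext_family n xs)) = 1"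
proof (rule ccontr)
  assume rk: "vec_space.rank 3 (gram S (ext_family n xs)) \<noteq> 1"
  note c = configD[OF cf]
  define G where "G = gram_entry S xs"
  define M where "M = gram S (ext_family n xs)"
  have M: "M \<in> carrier_mat 3 3" using c(8) by (simp add: M_def gram_def)
  have M_entry: "M $$ (i, j) = bordered G 2 i j" if "i < 3" "j < 3" for i j
    using gram_ext_family[OF c(2,6), of i j] that c(8) by (simp add: M_def G_def)
  have sym: "G 1 0 = G 0 1"
    using gram_entry_symmetric[OF c(2,3,6), of 1 0] c(8) by (simp add: G_def)
  have "shifted_nonsingular G 2"
    using invertible_imp_shifted_nonsingular[OF c(1,2,5,6,7)] c(8-10) by (simp add: G_def)
  then have G01: "G 0 1 = G 0 0 * G 1 1" using shifted_nonsingular_two sym by blast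
  (* Hence the bordered matrix is f f^T. *)
  define f where "f i = (if i = 0 then G 0 0 else if i = 1 then G 1 1 else G 0 0 + G 1 1)" for i :: nat
  have "M $$ (i, j) = f i * f j" if ij: "i < 3" "j < 3" for i j
  proof -
    have "i \<in> {0, 1, 2}" "j \<in> {0, 1, 2}" using ij by auto
    then show ?thesis using M_entry[OF ij] G01 sym
      by (cases "G 0 0"; cases "G 1 1") (auto simp: bordered_def f_def numeral_2_eq_2)
  qed
  then have "vec_space.rank 3 M \<le> 1"
    using vec_space.rank_le_1_product_entries[OF M] M by auto
  then have r0: "vec_space.rank 3 M = 0" using rk by (simp add: M_def)
  have "M $$ (i, i) = 0" if "i < 3" for i
  proof -
    have "col M i = 0\<^sub>v 3" using rank_ge_1[OF M that] r0 by linarith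
    then have "col M i $ i = 0" using that by simp
    then show ?thesis using M that by simp
  qed
  then have "G 0 0 = 0" "G 1 1 = 0" using M_entry[of 0 0] M_entry[of 1 1] by (simp_all add: bordered_def)
  then have "G i k = 0" if "i < 2" "k < 2" for i k
    using that G01 sym by (auto simp: less_2_cases_iff)
  then have "length xs + length xs \<le> n"
    using form_orthogonal_length_le[OF c(2,11,6,7,6,7)] c(8) by (simp add: G_def gram_entry_def)
  then show False using n c(8) by simp
qed

section \<open>Constructions\<close>

lemma gram_entry_unit_vecs:
  fixes S :: "'a :: comm_semiring_1 mat"
  assumes S: "S \<in> carrier_mat n n" and r: "r \<le> n" and ij: "i < r" "j < r"
  shows "gram_entry S (map (unit_vec n) [0..<r]) i j = S $$ (i, j)"
proof -
  have "unit_vec n i \<bullet> (S *\<^sub>v unit_vec n j) = (S *\<^sub>v unit_vec n j) $ i"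
    by (rule scalar_prod_left_unit) (use S ij r in auto)
  also have "\<dots> = S $$ (i, j)" using S ij r by simp
  finally show ?thesis using ij by (simp add: gram_entry_def)
qed

lemma shifted_nonsingular_cong:
  assumes "\<And>i j. i < r \<Longrightarrow> j < r \<Longrightarrow> G i j = H i j"
  shows "shifted_nonsingular G r \<longleftrightarrow> shifted_nonsingular H r"
proof -
  have "(\<Sum>j<r. G i j * u j) = (\<Sum>j<r. H i j * u j)" if "i < r" for i and u :: "nat \<Rightarrow> bit"
    using assms that by (intro sum.cong) auto
  then show ?thesis unfolding shifted_nonsingular_def by auto
qed

lemma bordered_cong:
  assumes "\<And>i j. i < r \<Longrightarrow> j < r \<Longrightarrow> G i j = H i j"
  shows "bordered G r i j = bordered H r i j"
  unfolding bordered_def using assms by (auto intro!: sum.cong)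

lemma exists_config_bordered:
  fixes S :: "bit mat"
  assumes S: "S \<in> carrier_mat n n" "transpose_mat S = S" "invertible_mat S"
    and r: "r \<le> n" "even r"
    and H: "\<And>i j. i < r \<Longrightarrow> j < r \<Longrightarrow> S $$ (i, j) = H i j"
    and ns: "shifted_nonsingular H r"
    and P: "P (vec_space.rank (r + 1) (mat (r + 1) (r + 1) (\<lambda>(i, j). bordered H r i j)))"
  shows "\<exists>A B Ainv xs. config n r A B Ainv xs \<and> P (vec_space.rank (r + 1) (gram Ainv (ext_family n xs)))"
proof -
  define xs :: "bit vec list" where "xs = map (unit_vec n) [0..<r]"
  have xs: "set xs \<subseteq> carrier_vec n" "lin_indep n xs" "length xs = r"
    using lin_indep_unit_vecs[OF r(1)] by (auto simp: xs_def)
  have G: "gram_entry S xs i j = H i j" if "i < r" "j < r" for i j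
    using gram_entry_unit_vecs[OF S(1) r(1) that] H[OF that] by (simp add: xs_def)
  obtain A where A: "A \<in> carrier_mat n n" "S * A = 1\<^sub>m n" "A * S = 1\<^sub>m n"
    using S(1,3) unfolding invertible_mat_def inverts_mat_def
    by (metis carrier_matD carrier_matI index_mult_mat(2,3) index_one_mat(2,3))
  have "transpose_mat A = A" by (rule symmetric_right_inverse[OF S(1) A(1) S(2) A(2)])
  moreover have "invertible_mat (A + sum_outer n (ext_family n xs))"
    using shifted_nonsingular_imp_invertible[OF A(1) S(1) A(2,3) xs(1,2)] xs(3) r(2) ns
      shifted_nonsingular_cong[OF G] by simp
  ultimately have "config n r A (A + sum_outer n (ext_family n xs)) S xs"
    using configI[OF A(1) _ S(1) A(3,2) xs] by blast
  moreover have "gram S (ext_family n xs) = mat (r + 1) (r + 1) (\<lambda>(i, j). bordered H r i j)"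
  proof (rule eq_matI)
    fix i j assume "i < dim_row (mat (r + 1) (r + 1) (\<lambda>(i, j). bordered H r i j))"
      "j < dim_col (mat (r + 1) (r + 1) (\<lambda>(i, j). bordered H r i j))"
    then have ij: "i \<le> r" "j \<le> r" by auto
    have "bordered (gram_entry S xs) r i j = bordered H r i j" by (rule bordered_cong[OF G])
    then show "gram S (ext_family n xs) $$ (i, j) = mat (r + 1) (r + 1) (\<lambda>(i, j). bordered H r i j) $$ (i, j)"
      using gram_ext_family[OF S(1) xs(1)] ij xs(3) by simp
  qed (simp_all add: gram_def xs(3))
  ultimately show ?thesis using P by metis
qed

definition perm_mat :: "nat \<Rightarrow> (nat \<Rightarrow> nat) \<Rightarrow> 'a :: zero_neq_one mat" where
  "perm_mat n \<sigma> = mat n n (\<lambda>(i, j). if \<sigma> i = j then 1 else 0)"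

lemma perm_mat_involution:
  assumes inv: "\<And>i. i < n \<Longrightarrow> \<sigma> i < n \<and> \<sigma> (\<sigma> i) = i"
  shows "transpose_mat (perm_mat n \<sigma>) = (perm_mat n \<sigma> :: 'a :: semiring_1 mat)"
    and "invertible_mat (perm_mat n \<sigma> :: 'a mat)"
proof -
  show "transpose_mat (perm_mat n \<sigma>) = (perm_mat n \<sigma> :: 'a mat)"
    using inv by (intro eq_matI) (auto simp: perm_mat_def)
  have "perm_mat n \<sigma> * perm_mat n \<sigma> = (1\<^sub>m n :: 'a mat)"
  proof (rule eq_matI)
    fix i k assume "i < dim_row (1\<^sub>m n :: 'a mat)" "k < dim_col (1\<^sub>m n :: 'a mat)"
    then have ik: "i < n" "k < n" by simp_all
    have "(perm_mat n \<sigma> * perm_mat n \<sigma> :: 'a mat) $$ (i, k)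
        = (\<Sum>j<n. (if \<sigma> i = j then 1 else 0) * (if \<sigma> j = k then 1 else 0))"
      using ik by (simp add: perm_mat_def scalar_prod_def atLeast0LessThan)
    also have "\<dots> = (\<Sum>j<n. if j = \<sigma> i then (if \<sigma> j = k then 1 else 0) else 0)"
      by (intro sum.cong) auto
    also have "\<dots> = (1\<^sub>m n :: 'a mat) $$ (i, k)" using inv ik by auto
    finally show "(perm_mat n \<sigma> * perm_mat n \<sigma> :: 'a mat) $$ (i, k) = (1\<^sub>m n :: 'a mat) $$ (i, k)" .
  qed (simp_all add: perm_mat_def)
  then show "invertible_mat (perm_mat n \<sigma> :: 'a mat)"
    unfolding invertible_mat_def inverts_mat_def by (auto simp: perm_mat_def)
qed

lemma shifted_nonsingular_corner:
  assumes r: "0 < r"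
  shows "shifted_nonsingular (\<lambda>i j. if i = 0 \<and> j = 0 then 1 else 0) r"
  unfolding shifted_nonsingular_def
proof (intro allI impI)
  fix u :: "nat \<Rightarrow> bit" and i
  assume h: "\<forall>i<r. (\<Sum>j<r. (if i = 0 \<and> j = 0 then 1 else 0) * u j) = u i + (\<Sum>j<r. u j)"
    and i: "i < r"
  have row: "(\<Sum>j<r. (if k = 0 \<and> j = 0 then 1 else 0) * u j) = (if k = 0 then u 0 else 0)" for k
  proof -
    have "(\<Sum>j<r. (if k = 0 \<and> j = 0 then 1 else 0) * u j) = (\<Sum>j<r. if j = 0 then (if k = 0 then u j else 0) else 0)"
      by (intro sum.cong) auto
    then show ?thesis using r by simp
  qed
  have "u 0 = u 0 + (\<Sum>j<r. u j)" using h[rule_format, OF r] row[of 0] by simp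
  then have sum0: "(\<Sum>j<r. u j) = 0" by simp
  have uk: "u k = 0" if "0 < k" "k < r" for k
    using h[rule_format, OF that(2)] row[of k] sum0 that by simp
  have "(\<Sum>j<r. u j) = (\<Sum>j<r. if j = 0 then u j else 0)"
    using uk by (intro sum.cong) auto
  then have "u 0 = 0" using sum0 r by simp
  then show "u i = 0" using uk i by (cases "i = 0") auto
qed

lemma shifted_nonsingular_zero:
  assumes "even r"
  shows "shifted_nonsingular (\<lambda>_ _. 0) r"
  unfolding shifted_nonsingular_def
proof (intro allI impI)
  fix u :: "nat \<Rightarrow> bit" and i
  assume h: "\<forall>i<r. (\<Sum>j<r. 0 * u j) = u i + (\<Sum>j<r. u j)" and i: "i < r"
  have "u k + (\<Sum>j<r. u j) = 0" if "k < r" for k using h that by simp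
  then have u: "u k = (\<Sum>j<r. u j)" if "k < r" for k using that bit_add_eq_0_iff by blast
  have "(\<Sum>j<r. u j) = (\<Sum>j<r. 0 + (\<Sum>j<r. u j))"
    using u by (intro sum.cong refl) (metis add_0_left lessThan_iff)
  also have "\<dots> = 0" using sum_add_const_even[OF assms, of "\<lambda>_. 0"] by simp
  finally show "u i = 0" using u[OF i] by simp
qed

lemma rank_bordered_corner:
  assumes r: "0 < r"
  shows "vec_space.rank (r + 1)
    (mat (r + 1) (r + 1) (\<lambda>(i, j). bordered (\<lambda>i j. if i = 0 \<and> j = 0 then 1 else 0 :: bit) r i j)) = 1"
proof -
  define H :: "nat \<Rightarrow> nat \<Rightarrow> bit" where "H i j = (if i = 0 \<and> j = 0 then 1 else 0)" for i j
  define f :: "nat \<Rightarrow> bit" where "f i = (if i = 0 \<or> i = r then 1 else 0)" for i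
  define M where "M = mat (r + 1) (r + 1) (\<lambda>(i, j). bordered H r i j)"
  have M: "M \<in> carrier_mat (r + 1) (r + 1)" by (simp add: M_def)
  have row: "(\<Sum>l<r. H k l) = (if k = 0 then 1 else 0)" for k
  proof -
    have "(\<Sum>l<r. H k l) = (\<Sum>l<r. if l = 0 then (if k = 0 then 1 else 0) else 0)"
      by (intro sum.cong) (auto simp: H_def)
    then show ?thesis using r by simp
  qed
  have col: "(\<Sum>k<r. H k l) = (if l = 0 then 1 else 0)" for l
    using row[of l] by (simp add: H_def conj_commute)
  have "M $$ (i, j) = f i * f j" if "i < r + 1" "j < r + 1" for i j
    using that r by (auto simp: M_def bordered_def row col f_def; simp add: H_def)
  then have "vec_space.rank (r + 1) M \<le> 1"
    using vec_space.rank_le_1_product_entries[OF M] M by auto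
  moreover have "col M 0 \<noteq> 0\<^sub>v (r + 1)"
  proof
    assume "col M 0 = 0\<^sub>v (r + 1)"
    then have "col M 0 $ 0 = 0" by simp
    then show False using r by (simp add: M_def bordered_def H_def)
  qed
  then have "1 \<le> vec_space.rank (r + 1) M" by (intro rank_ge_1[OF M]) simp_all
  ultimately show ?thesis unfolding M_def H_def by linarith
qed

lemma exists_config_rank_one:
  assumes r: "0 < r" "even r" and n: "2 * r \<le> n + 1"
  shows "\<exists>A B Ainv xs. config n r A B Ainv xs \<and> vec_space.rank (r + 1) (gram Ainv (ext_family n xs)) = 1"
proof -
  define \<sigma> where "\<sigma> i = (if i = 0 then 0 else if i < r then i + r - 1 else if i < 2 * r - 1 then i + 1 - r else i)"
    for i
  have inv: "\<sigma> i < n \<and> \<sigma> (\<sigma> i) = i" if "i < n" for i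
    using that n r by (auto simp: \<sigma>_def)
  define S :: "bit mat" where "S = perm_mat n \<sigma>"
  have S: "S \<in> carrier_mat n n" "transpose_mat S = S" "invertible_mat S"
    unfolding S_def using perm_mat_involution[OF inv] by (simp_all add: perm_mat_def)
  have SH: "S $$ (i, j) = (if i = 0 \<and> j = 0 then 1 else 0)" if "i < r" "j < r" for i j
    using that n by (auto simp: S_def perm_mat_def \<sigma>_def)
  have "r \<le> n" using n r by simp
  from exists_config_bordered[where P = "\<lambda>k. k = 1", OF S this r(2) SH
      shifted_nonsingular_corner[OF r(1)] rank_bordered_corner[OF r(1)]]
  show ?thesis .
qed

lemma exists_config_rank_zero:
  assumes r: "even r" and n: "2 * r \<le> n"
  shows "\<exists>A B Ainv xs. config n r A B Ainv xs \<and> vec_space.rank (r + 1) (gram Ainv (ext_family n xs)) = 0"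
proof -
  define \<sigma> where "\<sigma> i = (if i < r then i + r else if i < 2 * r then i - r else i)" for i
  have inv: "\<sigma> i < n \<and> \<sigma> (\<sigma> i) = i" if "i < n" for i
    using that n by (auto simp: \<sigma>_def)
  define S :: "bit mat" where "S = perm_mat n \<sigma>"
  have S: "S \<in> carrier_mat n n" "transpose_mat S = S" "invertible_mat S"
    unfolding S_def using perm_mat_involution[OF inv] by (simp_all add: perm_mat_def)
  have SH: "S $$ (i, j) = 0" if "i < r" "j < r" for i j
    using that n by (auto simp: S_def perm_mat_def \<sigma>_def)
  have "mat (r + 1) (r + 1) (\<lambda>(i, j). bordered (\<lambda>_ _. 0 :: bit) r i j) = 0\<^sub>m (r + 1) (r + 1)"
    by (intro eq_matI) (simp_all add: bordered_def)
  then have rank: "vec_space.rank (r + 1) (mat (r + 1) (r + 1) (\<lambda>(i, j). bordered (\<lambda>_ _. 0 :: bit) r i j)) = 0"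
    by (simp add: vec_space.rank_0I)
  have "r \<le> n" using n by simp
  from exists_config_bordered[where P = "\<lambda>k. k = 0", OF S this r SH shifted_nonsingular_zero[OF r] rank]
  show ?thesis .
qed

(* Row supports of a symmetric block-diagonal matrix: a 4 x 4 block on the indices 0..3, the block
   [[1, 1], [1, 0]] on each pair {i, i + 1} with i even and 4 <= i < r, and the identity from r on. *)
definition block_row :: "nat \<Rightarrow> nat \<Rightarrow> nat set" where
  "block_row r i =
    (if r \<le> i then {i} else if i = 0 then {1, 3} else if i = 1 then {0} else if i = 2 then {2, 3}
     else if i = 3 then {0, 2} else if even i then {i, Suc i} else {i - 1})"

definition block_mat :: "nat \<Rightarrow> nat \<Rightarrow> bit mat" where
  "block_mat r n = mat n n (\<lambda>(i, j). if j \<in> block_row r i then 1 else 0)"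

lemma mem_block_row_iff:
  assumes "4 \<le> r" "even r"
  shows "j \<in> block_row r i \<longleftrightarrow>
    (i, j) \<in> {(0, 1), (1, 0), (0, 3), (3, 0), (2, 2), (2, 3), (3, 2)}
    \<or> (4 \<le> i \<and> 4 \<le> j \<and> i < r \<and> j < r \<and> i div 2 = j div 2 \<and> (even i \<or> even j))
    \<or> (r \<le> i \<and> i = j)"
proof (cases "r \<le> i")
  case True
  then show ?thesis using assms by (auto simp: block_row_def)
next
  case False
  consider "i < 4" | "4 \<le> i" "even i" | "4 \<le> i" "odd i" by linarith
  then show ?thesis
  proof cases
    case 1
    then have "i = 0 \<or> i = 1 \<or> i = 2 \<or> i = 3" by auto
    then show ?thesis using assms False by (auto simp: block_row_def)
  next
    case 2
    then show ?thesis using assms False by (auto simp: block_row_def elim!: evenE oddE)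
  next
    case 3
    then show ?thesis using assms False by (auto simp: block_row_def elim!: evenE oddE)
  qed
qed

lemma block_row_symmetric:
  assumes "4 \<le> r" "even r"
  shows "j \<in> block_row r i \<longleftrightarrow> i \<in> block_row r j"
proof -
  have "i \<in> block_row r j" if h: "j \<in> block_row r i" for i j
  proof -
    consider "(i, j) \<in> {(0, 1), (1, 0), (0, 3), (3, 0), (2, 2), (2, 3), (3, 2)}"
      | "4 \<le> i \<and> 4 \<le> j \<and> i < r \<and> j < r \<and> i div 2 = j div 2 \<and> (even i \<or> even j)"
      | "r \<le> i \<and> i = j"
      using h unfolding mem_block_row_iff[OF assms] by blast
    then show ?thesis
    proof cases
      case 1
      then have "(j, i) \<in> {(0, 1), (1, 0), (0, 3), (3, 0), (2, 2), (2, 3), (3, 2)}" by blast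
      then show ?thesis unfolding mem_block_row_iff[OF assms] by blast
    next
      case 2
      then show ?thesis unfolding mem_block_row_iff[OF assms] by (metis (no_types))
    next
      case 3
      then show ?thesis using h by simp
    qed
  qed
  then show ?thesis by blast
qed

lemma block_row_small:
  assumes "4 \<le> r"
  shows "block_row r 0 = {1, 3}" "block_row r 1 = {0}" "block_row r 2 = {2, 3}" "block_row r 3 = {0, 2}"
  using assms by (simp_all add: block_row_def)

lemma block_row_pair:
  assumes "4 \<le> e" "even e" "e < r" "even r"
  shows "block_row r e = {e, Suc e}" "block_row r (Suc e) = {e}"
proof -
  have "Suc e < r" using assms by (metis Suc_lessI even_Suc)
  then show "block_row r e = {e, Suc e}" "block_row r (Suc e) = {e}"
    using assms by (auto simp: block_row_def)
qed

lemma block_row_subset: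
  assumes "4 \<le> r" "even r" "i < m" "r \<le> m"
  shows "block_row r i \<subseteq> {..<m}"
proof -
  have "Suc i < r" if "even i" "i < r" using that assms(2) by (metis Suc_lessI even_Suc)
  then show ?thesis using assms by (auto simp: block_row_def)
qed

lemma in_block_pair:
  assumes "4 \<le> k" "k < r" "even r"
  obtains e where "4 \<le> e" "even e" "e < r" "k = e \<or> k = Suc e"
proof (cases "even k")
  case False
  then have "4 \<le> k - 1" "even (k - 1)" "k - 1 < r" "k = Suc (k - 1)" using assms by (auto elim: oddE)
  then show ?thesis using that by blast
qed (use that assms in blast)

lemma sum_indicator_mult:
  fixes f :: "nat \<Rightarrow> 'a :: semiring_1"
  assumes "T \<subseteq> {..<m}"
  shows "(\<Sum>j<m. (if j \<in> T then 1 else 0) * f j) = (\<Sum>j\<in>T. f j)"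
proof -
  have "(\<Sum>j<m. (if j \<in> T then 1 else 0) * f j) = (\<Sum>j<m. if j \<in> T then f j else 0)"
    by (intro sum.cong) simp_all
  also have "\<dots> = (\<Sum>j\<in>{..<m} \<inter> T. f j)" by (simp add: sum.inter_restrict)
  also have "{..<m} \<inter> T = T" using assms by auto
  finally show ?thesis .
qed

lemma block_mat_row_sum:
  assumes "4 \<le> r" "even r" "r \<le> n" "i < n" "r \<le> m" "m \<le> n" "i < m"
  shows "(\<Sum>j<m. block_mat r n $$ (i, j) * f j) = (\<Sum>j\<in>block_row r i. f j)"
proof -
  have "(\<Sum>j<m. block_mat r n $$ (i, j) * f j) = (\<Sum>j<m. (if j \<in> block_row r i then 1 else 0) * f j)"
    using assms by (intro sum.cong) (auto simp: block_mat_def)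
  also have "\<dots> = (\<Sum>j\<in>block_row r i. f j)"
    by (rule sum_indicator_mult[OF block_row_subset[OF assms(1,2,7,5)]])
  finally show ?thesis .
qed

lemma block_mat_symmetric:
  assumes "4 \<le> r" "even r"
  shows "transpose_mat (block_mat r n) = block_mat r n"
  using block_row_symmetric[OF assms] by (intro eq_matI) (auto simp: block_mat_def)

lemma block_mat_invertible:
  assumes r: "4 \<le> r" "even r" "r \<le> n"
  shows "invertible_mat (block_mat r n)"
proof -
  have "y = 0\<^sub>v n" if y: "y \<in> carrier_vec n" and h: "block_mat r n *\<^sub>v y = 0\<^sub>v n" for y
  proof -
    have R: "(\<Sum>j\<in>block_row r i. y $ j) = 0" if i: "i < n" for i
    proof -
      have "(block_mat r n *\<^sub>v y) $ i = (\<Sum>j<n. block_mat r n $$ (i, j) * y $ j)"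
        using i y by (simp add: block_mat_def scalar_prod_def row_def atLeast0LessThan)
      also have "\<dots> = (\<Sum>j\<in>block_row r i. y $ j)" using block_mat_row_sum r i by simp
      finally show ?thesis using h i by simp
    qed
    have "y $ k = 0" if k: "k < n" for k
    proof -
      consider "r \<le> k" | "k < 4" | "4 \<le> k" "k < r" by linarith
      then show ?thesis
      proof cases
        case 1
        then show ?thesis using R[OF k] by (simp add: block_row_def)
      next
        case 2
        have "y $ 1 + y $ 3 = 0" "y $ 0 = 0" "y $ 2 + y $ 3 = 0" "y $ 0 + y $ 2 = 0"
          using R[of 0] R[of 1] R[of 2] R[of 3] block_row_small[OF r(1)] r by auto
        then have "y $ 0 = 0" "y $ 1 = 0" "y $ 2 = 0" "y $ 3 = 0" by (auto simp: bit_add_eq_0_iff)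
        then show ?thesis using 2 by (auto simp: less_Suc_eq eval_nat_numeral)
      next
        case 3
        then obtain e where e: "4 \<le> e" "even e" "e < r" "k = e \<or> k = Suc e"
          using in_block_pair r(2) by blast
        have "Suc e < r" using e r(2) by (metis Suc_lessI even_Suc)
        then have "y $ e = 0" "y $ e + y $ Suc e = 0"
          using R[of "Suc e"] R[of e] block_row_pair[OF e(1-3) r(2)] e(3) r(3) by simp_all
        then show ?thesis using e(4) by auto
      qed
    qed
    then show ?thesis using y by (intro eq_vecI) auto
  qed
  then show ?thesis using invertible_mat_iff_trivial_kernel[of "block_mat r n" n]
    by (simp add: block_mat_def)
qed

lemma shifted_nonsingular_block_mat:
  assumes r: "4 \<le> r" "even r" "r \<le> n"
  shows "shifted_nonsingular (\<lambda>i j. block_mat r n $$ (i, j)) r"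
  unfolding shifted_nonsingular_def
proof (intro allI impI)
  fix u :: "nat \<Rightarrow> bit" and i
  assume h: "\<forall>i<r. (\<Sum>j<r. block_mat r n $$ (i, j) * u j) = u i + (\<Sum>j<r. u j)" and i: "i < r"
  define s where "s = (\<Sum>j<r. u j)"
  have H: "(\<Sum>j\<in>block_row r k. u j) = u k + s" if "k < r" for k
    using h[rule_format, OF that] block_mat_row_sum[OF r(1,2,3) _ order.refl r(3), of k u] that r(3)
    by (simp add: s_def)
  have "u 1 + u 3 = u 0 + s" "u 0 = u 1 + s" "u 2 + u 3 = u 2 + s" "u 0 + u 2 = u 3 + s"
    using H[of 0] H[of 1] H[of 2] H[of 3] block_row_small[OF r(1)] r(1) by auto
  then have q: "s = 0" "u 3 = 0" "u 1 = u 0" "u 2 = u 0"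
    by (cases "u 0"; cases "u 1"; cases "u 2"; cases "u 3"; cases s; simp)+
  have high: "u k = 0" if k: "4 \<le> k" "k < r" for k
  proof -
    obtain e where e: "4 \<le> e" "even e" "e < r" "k = e \<or> k = Suc e"
      using in_block_pair[OF k r(2)] by blast
    have "Suc e < r" using e r(2) by (metis Suc_lessI even_Suc)
    then have "u e = u (Suc e)" "u e + u (Suc e) = u e"
      using H[of "Suc e"] H[of e] block_row_pair[OF e(1-3) r(2)] q(1) e(3) by simp_all
    then show ?thesis using e(4) by (cases "u e"; cases "u (Suc e)") auto
  qed
  have "s = (\<Sum>j<4. u j)" unfolding s_def
    by (rule sum.mono_neutral_right) (use r(1) high in auto)
  then have "u 0 = 0" using q by (simp add: eval_nat_numeral)
  then show "u i = 0" using q high i by (cases "i < 4") (auto simp: less_Suc_eq eval_nat_numeral)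
qed

lemma exists_config_rank_ge_2:
  assumes r: "4 \<le> r" "even r" "r \<le> n"
  shows "\<exists>A B Ainv xs. config n r A B Ainv xs \<and> 2 \<le> vec_space.rank (r + 1) (gram Ainv (ext_family n xs))"
proof -
  define H where "H i j = block_mat r n $$ (i, j)" for i j
  define M where "M = mat (r + 1) (r + 1) (\<lambda>(i, j). bordered H r i j)"
  have M: "M \<in> carrier_mat (r + 1) (r + 1)" by (simp add: M_def)
  have M_entry: "M $$ (i, j) = (if j \<in> block_row r i then 1 else 0)" if "i < 2" "j < 2" for i j
    using that r by (simp add: M_def bordered_def H_def block_mat_def)
  have cols: "col M 0 $ 0 = 0" "col M 0 $ 1 = 1" "col M 1 $ 0 = 1" "col M 1 $ 1 = 0"
    using M_entry[of 0 0] M_entry[of 1 0] M_entry[of 0 1] M_entry[of 1 1] block_row_small[OF r(1)] r(1) M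
    by auto
  have "col M 0 \<noteq> 0\<^sub>v (r + 1)" "col M 1 \<noteq> 0\<^sub>v (r + 1)" "col M 0 \<noteq> col M 1"
  proof -
    have "(0\<^sub>v (r + 1) :: bit vec) $ 0 = 0" "(0\<^sub>v (r + 1) :: bit vec) $ 1 = 0" using r(1) by simp_all
    then show "col M 0 \<noteq> 0\<^sub>v (r + 1)" "col M 1 \<noteq> 0\<^sub>v (r + 1)" "col M 0 \<noteq> col M 1"
      using cols by (metis zero_neq_one)+
  qed
  then have rank: "2 \<le> vec_space.rank (r + 1) M"
    using rank_ge_2_bit[OF M, of 0 1] r(1) by simp
  have S: "block_mat r n \<in> carrier_mat n n" "transpose_mat (block_mat r n) = block_mat r n"
    "invertible_mat (block_mat r n)"
    using block_mat_symmetric[OF r(1,2)] block_mat_invertible[OF r] by (simp_all add: block_mat_def)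
  from exists_config_bordered[where P = "\<lambda>k. 2 \<le> k", OF S r(3,2) _
      shifted_nonsingular_block_mat[OF r, folded H_def] rank[unfolded M_def]]
  show ?thesis by (simp add: H_def)
qed

lemma exists_config_rank_neq_1:
  assumes r: "even r" "0 < r" "r \<le> n" and excluded: "(r, n) \<notin> {(2, 2), (2, 3)}"
  shows "\<exists>A B Ainv xs. config n r A B Ainv xs \<and> vec_space.rank (r + 1) (gram Ainv (ext_family n xs)) \<noteq> 1"
proof -
  have "r = 2 \<or> 4 \<le> r" using r(1,2) by presburger
  then consider "4 \<le> r" | "2 * r \<le> n" using r(3) excluded by fastforce
  then show ?thesis
  proof cases
    case 1
    then show ?thesis using exists_config_rank_ge_2[OF 1 r(1,3)] by fastforce
  next
    case 2
    then show ?thesis using exists_config_rank_zero[OF r(1) 2] by fastforce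
  qed
qed

theorem lemma7p2:
  fixes n r :: nat
  assumes "n \<ge> 2" and "even r" and "0 < r" and "r \<le> n"
  shows "((\<exists>A B Ainv xs. config n r A B Ainv xs
            \<and> vec_space.rank (r + 1) (gram Ainv (ext_family n xs)) \<noteq> 1)
           \<longleftrightarrow> (r, n) \<notin> {(2, 2), (2, 3)})
       \<and> ((\<exists>A B Ainv xs. config n r A B Ainv xs
            \<and> vec_space.rank (r + 1) (gram Ainv (ext_family n xs)) = 1)
           \<longleftrightarrow> r \<le> (n + 1) div 2)"
proof -
  (* The hypothesis n \<ge> 2 is implied by the others and not needed. *)
  have "2 * r \<le> n + 1 \<longleftrightarrow> r \<le> (n + 1) div 2" by linarith
  then show ?thesis
    using config_two_gram_rank_one exists_config_rank_neq_1[OF assms(2-4)]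
      config_gram_rank_one_bound exists_config_rank_one[OF assms(3,2)]
    by fastforce
qed

end
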